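(* Let $A\in\mathbb{C}^{n\times n}$ be a negative definite Hermitian matrix and consider the problem (qOMM) $$\min_{Y\in\mathcal{OB}(n,p)} E_0(Y)=\mathrm{tr}\big((2I-Y^*Y)\,Y^*AY\big).$$ Every stationary point of qOMM is of the form $XP$, where $P\in\mathbb{R}^{p\times p}$ is a permutation matrix and $X\in\mathbb{C}^{n\times p}$ has a column block structure $X=(X_1,\dots,X_k)$ for some number $k$ of blocks, with $X_i\in\mathbb{C}^{n\times p_i}$ of rank $r_i$ and with reduced SVDs $X_i=U_i\Sigma_iV_i^*$, where $U_i\in\mathbb{C}^{n\times r_i}$, $\Sigma_i=\mathrm{diag}(\sigma_{i1},\dots,\sigma_{ir_i})$ contains the nonzero singular values, and $V_i\in\mathbb{C}^{p_i\times r_i}$, such that, with $U=(U_1,\dots,U_k)$, the following conditions hold. 1. $U$ is partial unitary and diagonalizes $A$, i.e. $U^*U=I$ and $U^*AU$ is diagonal. 2. Denote the $j$-th diagonal entry of $U_i^*AU_i$ by $\tilde a_{ij}$. Then $$\sigma_{ij}=\sqrt{1+\frac{p_i-r_i}{\tilde a_{ij}\sum_{\ell=1}^{r_i}\frac{1}{\tilde a_{i\ell}}}}\;\ge 1 .$$ Furthermore, if the $j$-th column $u_{ij}$ of $U_i$ is not an eigenvector of $A$, then $\sigma_{ij}=\sqrt2$. 3. At most one block $X_i$ is of full rank (i.e. $r_i=p_i$), and for such a block $X_i=U_iV_i^*$. 4. The right singular vector matrix $V_i\in\mathbb{C}^{p_i\times r_i}$ is partial unitary and such that $X_i\in\mathcal{OB}(n,p_i)$.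 The existence of such a $V_i$ is guaranteed for any given $U_i$ (with $\Sigma_i$ given by the formula in condition 2). In addition, any $X\in\mathbb{C}^{n\times p}$ satisfying the conditions above is a stationary point of qOMM, and so is $XP$ for an arbitrary permutation matrix $P$.
   Context: Let $1\le p\le n$ be integers. $X^*$ denotes the conjugate transpose and $I$ an identity matrix of suitable size. The oblique manifold is $\mathcal{OB}(n,p)=\{X\in\mathbb{C}^{n\times p}:\ (X^*X)_{jj}=1 \text{ for } j=1,\dots,p\}$ (all columns of unit length). A matrix $M$ is called partial unitary if its columns are orthonormal, $M^*M=I$. The diagonal entries of the singular value matrices $\Sigma_i$ are not required to be sorted. A stationary point of qOMM is a matrix $X\in\mathcal{OB}(n,p)$ satisfying the first-order condition of the Lagrangian $L(X,D)=\mathrm{tr}((2I-X^*X)X^*AX)+\mathrm{tr}(D^\top(X^*X-I))$, i.e. there is a real diagonal matrix $D=\mathrm{diag}(d_1,\dots,d_p)$ with $$2AX-AXX^*X-XX^*AX+XD=0 .$$ *)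

theory Defs
  imports
    Complex_Main
    "HOL-Combinatorics.Permutations"
    "Jordan_Normal_Form.Char_Poly"
    "Jordan_Normal_Form.Schur_Decomposition"
    "Jordan_Normal_Form.DL_Rank"
begin

text \<open>All indices are 0-based: the blocks are numbered by \<open>i < k\<close>, and rows and columns start at 0.
  The conjugate transpose is \<^const>\<open>mat_adjoint\<close>.\<close>

definition hermitian_mat :: "complex mat \<Rightarrow> bool" where
  "hermitian_mat A \<longleftrightarrow> mat_adjoint A = A"

text \<open>\<open>(A *\<^sub>v x) \<bullet>c x\<close> is the quadratic form of \<open>A\<close> at \<open>x\<close>, conjugated in \<open>x\<close> on the left;
  it is real for Hermitian \<open>A\<close>.\<close>

definition negative_definite_mat :: "nat \<Rightarrow> complex mat \<Rightarrow> bool" where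
  "negative_definite_mat n A \<longleftrightarrow> A \<in> carrier_mat n n \<and> hermitian_mat A \<and>
     (\<forall>x \<in> carrier_vec n. x \<noteq> 0\<^sub>v n \<longrightarrow> Re ((A *\<^sub>v x) \<bullet>c x) < 0)"

definition oblique_manifold :: "nat \<Rightarrow> nat \<Rightarrow> complex mat set" where
  "oblique_manifold n p =
     {X \<in> carrier_mat n p. \<forall>j<p. (mat_adjoint X * X) $$ (j, j) = 1}"

definition partial_unitary :: "complex mat \<Rightarrow> bool" where
  "partial_unitary M \<longleftrightarrow> mat_adjoint M * M = 1\<^sub>m (dim_col M)"

definition real_diag :: "nat \<Rightarrow> (nat \<Rightarrow> real) \<Rightarrow> complex mat" where
  "real_diag r s = mat_diag r (\<lambda>j. complex_of_real (s j))"

text \<open>First-order condition of the Lagrangian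
  \<open>L(X, D) = tr ((2 I - X\<^sup>* X) X\<^sup>* A X) + tr (D\<^sup>T (X\<^sup>* X - I))\<close> of the minimization of
  \<open>E\<^sub>0(X) = tr ((2 I - X\<^sup>* X) X\<^sup>* A X)\<close> over the oblique manifold: the matrix equation is
  the vanishing of the gradient in \<open>X\<close>, with real diagonal multiplier \<open>D\<close>.\<close>

definition qomm_stationary :: "nat \<Rightarrow> nat \<Rightarrow> complex mat \<Rightarrow> complex mat \<Rightarrow> bool" where
  "qomm_stationary n p A X \<longleftrightarrow> X \<in> oblique_manifold n p \<and>
     (\<exists>d :: nat \<Rightarrow> real.
        2 \<cdot>\<^sub>m (A * X) - A * X * mat_adjoint X * X - X * mat_adjoint X * A * X
          + X * real_diag p d = 0\<^sub>m n p)"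

definition permutation_matrix :: "nat \<Rightarrow> real mat \<Rightarrow> bool" where
  "permutation_matrix p P \<longleftrightarrow>
     (\<exists>\<pi>. \<pi> permutes {..<p} \<and> P = mat p p (\<lambda>(i, j). if i = \<pi> j then 1 else 0))"

text \<open>The block row \<open>(M 0, \<dots>, M (k - 1))\<close>, for matrices \<open>M i\<close> with \<open>n\<close> rows.\<close>

definition block_row :: "nat \<Rightarrow> nat \<Rightarrow> (nat \<Rightarrow> complex mat) \<Rightarrow> complex mat" where
  "block_row n k M = mat_of_cols n (concat (map (\<lambda>i. cols (M i)) [0..<k]))"

text \<open>The singular values \<open>s 0, \<dots>, s (r - 1)\<close> are not required to be sorted.\<close>

definition reduced_svd ::
  "nat \<Rightarrow> nat \<Rightarrow> nat \<Rightarrow> complex mat \<Rightarrow> complex mat \<Rightarrow> (nat \<Rightarrow> real) \<Rightarrow> complex mat \<Rightarrow> bool" where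
  "reduced_svd n q r M U s V \<longleftrightarrow>
     M \<in> carrier_mat n q \<and> U \<in> carrier_mat n r \<and> V \<in> carrier_mat q r \<and>
     partial_unitary U \<and> partial_unitary V \<and> (\<forall>j<r. 0 < s j) \<and>
     M = U * real_diag r s * mat_adjoint V"

text \<open>The \<open>j\<close>-th diagonal entry of \<open>U\<^sup>* A U\<close>, which is a real number for Hermitian \<open>A\<close>.\<close>

definition diag_entry :: "complex mat \<Rightarrow> complex mat \<Rightarrow> nat \<Rightarrow> real" where
  "diag_entry A U j = Re ((mat_adjoint U * A * U) $$ (j, j))"

definition sigma_formula :: "complex mat \<Rightarrow> nat \<Rightarrow> nat \<Rightarrow> complex mat \<Rightarrow> nat \<Rightarrow> real" where
  "sigma_formula A q r U j =
     sqrt (1 + (real q - real r) / (diag_entry A U j * (\<Sum>l<r. 1 / diag_entry A U l)))"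

text \<open>\<open>X\<close> is the block row of \<open>Xs i\<close> for \<open>i < k\<close>, where \<open>Xs i\<close> has \<open>ps i \<ge> 1\<close> columns, rank
  \<open>rs i\<close> and reduced SVD given by \<open>Us i\<close>, \<open>\<sigma> i\<close>, \<open>Vs i\<close>.\<close>

definition svd_block_structure ::
  "nat \<Rightarrow> nat \<Rightarrow> nat \<Rightarrow> (nat \<Rightarrow> nat) \<Rightarrow> (nat \<Rightarrow> nat) \<Rightarrow> (nat \<Rightarrow> complex mat) \<Rightarrow> (nat \<Rightarrow> complex mat) \<Rightarrow>
   (nat \<Rightarrow> nat \<Rightarrow> real) \<Rightarrow> (nat \<Rightarrow> complex mat) \<Rightarrow> complex mat \<Rightarrow> bool" where
  "svd_block_structure n p k ps rs Xs Us \<sigma> Vs X \<longleftrightarrow>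
     (\<forall>i<k. 1 \<le> ps i) \<and> (\<Sum>i<k. ps i) = p \<and>
     (\<forall>i<k. Xs i \<in> carrier_mat n (ps i) \<and> vec_space.rank n (Xs i) = rs i \<and>
        reduced_svd n (ps i) (rs i) (Xs i) (Us i) (\<sigma> i) (Vs i)) \<and>
     X = block_row n k Xs"

definition qomm_conditions ::
  "nat \<Rightarrow> complex mat \<Rightarrow> nat \<Rightarrow> (nat \<Rightarrow> nat) \<Rightarrow> (nat \<Rightarrow> nat) \<Rightarrow> (nat \<Rightarrow> complex mat) \<Rightarrow>
   (nat \<Rightarrow> complex mat) \<Rightarrow> (nat \<Rightarrow> nat \<Rightarrow> real) \<Rightarrow> (nat \<Rightarrow> complex mat) \<Rightarrow> bool" where
  "qomm_conditions n A k ps rs Xs Us \<sigma> Vs \<longleftrightarrow>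
     (partial_unitary (block_row n k Us) \<and>
      diagonal_mat (mat_adjoint (block_row n k Us) * A * block_row n k Us)) \<and>
     (\<forall>i<k. \<forall>j<rs i.
        \<sigma> i j = sigma_formula A (ps i) (rs i) (Us i) j \<and> 1 \<le> \<sigma> i j \<and>
        ((\<nexists>c. eigenvector A (col (Us i) j) c) \<longrightarrow> \<sigma> i j = sqrt 2)) \<and>
     ((\<forall>i<k. \<forall>i'<k. rs i = ps i \<and> rs i' = ps i' \<longrightarrow> i = i') \<and>
      (\<forall>i<k. rs i = ps i \<longrightarrow> Xs i = Us i * mat_adjoint (Vs i))) \<and>
     (\<forall>i<k. partial_unitary (Vs i) \<and> Xs i \<in> oblique_manifold n (ps i))"

end

(* Put S = X X^* and M = 2A - AS - SA. The first-order condition says exactly that every column x_j of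
   X is an eigenvector of the Hermitian matrix M with eigenvalue -d_j. Columns with different d_j are
   therefore orthogonal, which gives the blocks X_i. The left singular vectors u of X_i satisfy
   S u = s^2 u and M u = -d u, so u'^* M u = (2 - s^2 - s'^2) u'^* A u: the diagonal case gives
   s^2 = 1 + d / (2 u^* A u), the trace of X_i^* X_i determines d, and s, s' >= 1 makes the off-diagonal
   entries of U^* A U vanish unless d = 0, where X_i is partial unitary and U_i can be rotated.
   Finally (2 - s^2) A u is a multiple of u. The converse reverses these steps. Columns
   of the normalized q x q discrete Fourier matrix, whose entries all have modulus q^(-1/2), serve as V_i. *)
theory Submission
  imports Defs "Jordan_Normal_Form.Spectral_Radius"
begin

section \<open>Adjoints and the spectral theorem\<close>

text \<open>The inequality s \<ge> 1 has to be known before \<open>U^* A U\<close> is known to be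
  diagonal, and it comes from the diagonal entries alone. Every a = u^* A u is negative, and summing
  s^2 = 1 + d / (2 a) over the r singular vectors of a block with q columns gives q = r + (d / 2) Q,
  where Q is the sum of the 1 / a. As r \<le> q, this forces d \<le> 0, with equality exactly for
  full rank. The blocks have pairwise different multipliers, so d = 0 occurs in at most one of them:
  this is the block of full rank, the only one with singular values 1, and the only place where the
  factor 2 - s^2 - s'^2 can vanish and a rotation is required. The value sqrt 2 is explained by M u
  = (2 - s^2) A u - s^2 a u: at s^2 = 2 the matrix A drops out, so the equation M u = -d u neither
  forces u to be an eigenvector of A nor requires it. The second term is correct even if A u leaves
  the column space of U, because S = U Sigma^2 U^* and U^* A U is diagonal.\<close>

lemma index_mult_mat_sum:
  "i < dim_row A \<Longrightarrow> j < dim_col B \<Longrightarrow> dim_col A = dim_row B \<Longrightarrow>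
   (A * B) $$ (i, j) = (\<Sum>k<dim_row B. A $$ (i, k) * B $$ (k, j))"
  by (simp add: scalar_prod_def lessThan_atLeast0)

lemma mult_mat_assoc:
  fixes A B C :: "'a :: semiring_0 mat"
  shows "dim_col A = dim_row B \<Longrightarrow> dim_col B = dim_row C \<Longrightarrow> A * B * C = A * (B * C)"
  by (rule assoc_mult_mat[of _ "dim_row A" "dim_col A" _ "dim_col B" _ "dim_col C"]) auto

lemma dim_mat_adjoint [simp]:
  "dim_row (mat_adjoint A) = dim_col A" "dim_col (mat_adjoint A) = dim_row A"
  by (auto simp: mat_adjoint_def)

lemma mat_adjoint_carrier [simp]: "A \<in> carrier_mat n m \<Longrightarrow> mat_adjoint A \<in> carrier_mat m n"
  by (auto intro: carrier_matI)

lemma index_mat_adjoint [simp]: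
  "i < dim_col A \<Longrightarrow> j < dim_row A \<Longrightarrow> mat_adjoint A $$ (i, j) = conjugate (A $$ (j, i))"
  by (simp add: mat_adjoint_def mat_of_rows_def)

lemma mat_adjoint_adjoint [simp]: "mat_adjoint (mat_adjoint A) = A"
  by (rule eq_matI) auto

lemma mat_adjoint_mult:
  fixes A B :: "complex mat"
  shows "dim_col A = dim_row B \<Longrightarrow> mat_adjoint (A * B) = mat_adjoint B * mat_adjoint A"
  by (rule eq_matI) (auto simp: index_mult_mat_sum mult.commute simp del: index_mult_mat(1))

lemma index_adjoint_mult:
  fixes A B :: "complex mat"
  shows "i < dim_col A \<Longrightarrow> j < dim_col B \<Longrightarrow> dim_row A = dim_row B \<Longrightarrow>
    (mat_adjoint A * B) $$ (i, j) = col B j \<bullet>c col A i"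
  by (auto simp: scalar_prod_def mult.commute intro!: sum.cong)

lemma index_adjoint_sandwich:
  fixes A :: "complex mat"
  assumes "A \<in> carrier_mat n n" "P \<in> carrier_mat n q" "R \<in> carrier_mat n r" "i < q" "j < r"
  shows "(mat_adjoint P * A * R) $$ (i, j) = (A *\<^sub>v col R j) \<bullet>c col P i"
proof -
  have "mat_adjoint P * A * R = mat_adjoint P * (A * R)" using assms by (simp add: mult_mat_assoc)
  moreover have "(mat_adjoint P * (A * R)) $$ (i, j) = col (A * R) j \<bullet>c col P i"
    by (rule index_adjoint_mult) (use assms in auto)
  ultimately show ?thesis using col_mult2[OF assms(1,3,5)] by simp
qed

lemma partial_unitary_iff:
  "partial_unitary M \<longleftrightarrow> (\<forall>i<dim_col M. \<forall>j<dim_col M. col M j \<bullet>c col M i = (if i = j then 1 else 0))"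
  unfolding partial_unitary_def
proof
  assume "mat_adjoint M * M = 1\<^sub>m (dim_col M)"
  then show "\<forall>i<dim_col M. \<forall>j<dim_col M. col M j \<bullet>c col M i = (if i = j then 1 else 0)"
    by (metis index_adjoint_mult index_one_mat(1))
qed (auto intro!: eq_matI simp: index_adjoint_mult simp del: index_mult_mat(1))

lemma partial_unitary_mult:
  assumes "partial_unitary M" "partial_unitary N" "dim_col M = dim_row N"
  shows "partial_unitary (M * N)"
proof -
  have "mat_adjoint (M * N) * (M * N) = mat_adjoint N * (mat_adjoint M * M) * N"
    using assms(3) by (simp add: mat_adjoint_mult mult_mat_assoc)
  then show ?thesis using assms by (simp add: partial_unitary_def)
qed

lemma partial_unitary_square:
  assumes "M \<in> carrier_mat m m" "partial_unitary M"
  shows "M * mat_adjoint M = 1\<^sub>m m"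
  using assms mat_mult_left_right_inverse[of "mat_adjoint M" m M]
  by (auto simp: partial_unitary_def)

text \<open>Gram-Schmidt keeps the head of a completed basis and makes the list orthogonal; scaling
  by \<open>f\<close> then gives unit columns. The factor \<open>c\<close> is left open because only
  the direction of an eigenvector matters.\<close>

lemma exists_unitary_first_col:
  assumes v: "v \<in> carrier_vec n" and v0: "v \<noteq> 0\<^sub>v n"
  shows "\<exists>W c. W \<in> carrier_mat n n \<and> partial_unitary W \<and> col W 0 = c \<cdot>\<^sub>v (v :: complex vec)"
proof -
  interpret cof_vec_space n "TYPE(complex)" .
  have n: "n > 0" using v v0 by (cases n) (auto intro!: eq_vecI)
  note bc = basis_completion[OF v v0]
  define ws where "ws = gram_schmidt n (basis_completion v)"
  note gs = gram_schmidt_result[OF bc(2,4,5) ws_def]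
  have hd: "ws ! 0 = v"
  proof -
    obtain u us where b: "basis_completion v = u # us" using bc(6) n by (cases "basis_completion v") auto
    with bc(7) have "u = v" by simp
    have "u \<in> carrier_vec n" using bc(2) b by auto
    then have "hd ws = u" unfolding ws_def b by (rule gram_schmidt_hd)
    moreover have "ws \<noteq> []" using gs(4) bc(6) n by auto
    ultimately show ?thesis using \<open>u = v\<close> by (simp add: hd_conv_nth)
  qed
  have len: "length ws = n" using gs(4) bc(6) by simp
  define f where "f w = complex_of_real (1 / sqrt (Re (w \<bullet>c w)))" for w :: "complex vec"
  have f: "f w * cnj (f w) * (w \<bullet>c w) = 1" if "w \<in> carrier_vec n" "w \<noteq> 0\<^sub>v n" for w
  proof -
    have "w \<bullet>c w > 0" using that by simp
    then have *: "w \<bullet>c w = of_real (Re (w \<bullet>c w))" "Re (w \<bullet>c w) > 0"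
      by (auto simp: less_complex_def complex_eq_iff)
    show ?thesis
      unfolding f_def using *(2) by (subst (3) *(1)) (simp flip: of_real_mult)
  qed
  define W where "W = mat_of_cols n (map (\<lambda>w. f w \<cdot>\<^sub>v w) ws)"
  have wsc: "ws ! i \<in> carrier_vec n" if "i < n" for i using gs(3) len that by auto
  have colW: "col W i = f (ws ! i) \<cdot>\<^sub>v ws ! i" if "i < n" for i
    unfolding W_def using that len wsc[OF that] by (subst col_mat_of_cols) auto
  have W: "W \<in> carrier_mat n n" unfolding W_def using len by (auto intro: carrier_matI)
  have ws0: "ws ! i \<noteq> 0\<^sub>v n" if "i < n" for i
    using gs(2) that len corthogonalD[OF gs(2), of i i] by auto
  have "partial_unitary W"
    unfolding partial_unitary_iff
  proof (intro allI impI)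
    fix i j assume "i < dim_col W" "j < dim_col W"
    then have ij: "i < n" "j < n" using W by auto
    have "col W j \<bullet>c col W i = f (ws ! j) * cnj (f (ws ! i)) * (ws ! j \<bullet>c ws ! i)"
      using ij wsc[OF ij(1), THEN carrier_vecD] wsc[OF ij(2), THEN carrier_vecD]
      by (simp add: colW conjugate_smult_vec scalar_prod_def sum_distrib_left mult_ac)
    also have "\<dots> = (if i = j then 1 else 0)"
      using f[OF wsc ws0] corthogonalD[OF gs(2), of j i] ij len by auto
    finally show "col W j \<bullet>c col W i = (if i = j then 1 else 0)" .
  qed
  moreover have "col W 0 = f v \<cdot>\<^sub>v v" using colW[of 0] n hd by simp
  ultimately show ?thesis using W by blast
qed

lemma hermitian_matD:
  "hermitian_mat H \<Longrightarrow> i < dim_row H \<Longrightarrow> j < dim_row H \<Longrightarrow> H $$ (i, j) = cnj (H $$ (j, i))"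
  unfolding hermitian_mat_def by (metis conjugate_complex_def dim_mat_adjoint(1) index_mat_adjoint)

lemma hermitian_mat_conj:
  assumes "hermitian_mat H" "dim_row W = dim_row H"
  shows "hermitian_mat (mat_adjoint W * H * W)"
  using assms unfolding hermitian_mat_def
  by (metis mat_adjoint_adjoint mat_adjoint_mult dim_mat_adjoint index_mult_mat(2,3) mult_mat_assoc)

lemma mat_adjoint_real_diag [simp]: "mat_adjoint (real_diag r s) = real_diag r s"
  by (rule eq_matI) (auto simp: real_diag_def mat_diag_def)

lemma real_diag_carrier [simp]: "real_diag r s \<in> carrier_mat r r"
  by (auto simp: real_diag_def)

lemma dim_real_diag [simp]: "dim_row (real_diag r s) = r" "dim_col (real_diag r s) = r"
  by (auto simp: real_diag_def mat_diag_def)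

lemma index_real_diag [simp]:
  "i < r \<Longrightarrow> j < r \<Longrightarrow> real_diag r s $$ (i, j) = (if i = j then complex_of_real (s j) else 0)"
  by (simp add: real_diag_def mat_diag_def)

text \<open>Deflation: a unitary change of basis puts an eigenvector first, and Hermitian symmetry
  clears the first row together with the first column, so the induction hypothesis applies to the
  remaining corner.\<close>

lemma hermitian_diagonalization:
  assumes "H \<in> carrier_mat m m" "hermitian_mat H"
  shows "\<exists>W l. W \<in> carrier_mat m m \<and> partial_unitary W \<and> mat_adjoint W * H * W = real_diag m l"
  using assms
proof (induction m arbitrary: H)
  case 0
  then show ?case by (intro exI[of _ "1\<^sub>m 0"]) (auto simp: partial_unitary_def intro!: eq_matI)
next
  case (Suc m)
  obtain e v where ev: "eigenvector H v e"
    using spectrum_non_empty[OF Suc.prems(1)] unfolding spectrum_def eigenvalue_def by auto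
  then have v: "v \<in> carrier_vec (Suc m)" "v \<noteq> 0\<^sub>v (Suc m)" "H *\<^sub>v v = e \<cdot>\<^sub>v v"
    using Suc.prems(1) unfolding eigenvector_def by auto
  obtain W c where W: "W \<in> carrier_mat (Suc m) (Suc m)" "partial_unitary W" "col W 0 = c \<cdot>\<^sub>v v"
    using exists_unitary_first_col[OF v(1,2)] by blast
  define B where "B = mat_adjoint W * H * W"
  have B: "B \<in> carrier_mat (Suc m) (Suc m)" using W Suc.prems unfolding B_def by auto
  have hB: "hermitian_mat B" unfolding B_def using W Suc.prems by (intro hermitian_mat_conj) auto
  have col0: "B $$ (i, 0) = (if i = 0 then e else 0)" if i: "i < Suc m" for i
  proof -
    have "H *\<^sub>v col W 0 = e \<cdot>\<^sub>v col W 0"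
      using W(3) v Suc.prems(1) by (simp add: mult_mat_vec smult_smult_assoc mult.commute)
    then have "col (H * W) 0 = e \<cdot>\<^sub>v col W 0"
      using W Suc.prems by (subst col_mult2) auto
    then have "B $$ (i, 0) = (e \<cdot>\<^sub>v col W 0) \<bullet>c col W i"
      using i W Suc.prems unfolding B_def
      by (simp add: mult_mat_assoc index_adjoint_mult del: index_mult_mat(1))
    also have "\<dots> = e * (col W 0 \<bullet>c col W i)"
      using col_carrier_vec[OF _ W(1)] i by (intro smult_scalar_prod_distrib[of _ "Suc m"]) auto
    also have "\<dots> = (if i = 0 then e else 0)"
      using W(2) i W(1) unfolding partial_unitary_iff by auto
    finally show ?thesis .
  qed
  have row0: "B $$ (0, j) = (if j = 0 then e else 0)" if "j < Suc m" for j
    using hermitian_matD[OF hB, of 0 j] col0[of j] col0[of 0] B that by auto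
  define C where "C = mat m m (\<lambda>(i, j). B $$ (Suc i, Suc j))"
  have C: "C \<in> carrier_mat m m" by (simp add: C_def)
  have "hermitian_mat C"
    unfolding hermitian_mat_def
  proof (rule eq_matI, goal_cases)
    case (1 i j)
    then have "i < m" "j < m" by (auto simp: C_def)
    then show ?case
      using hermitian_matD[OF hB, of "Suc i" "Suc j"] B by (simp add: C_def)
  qed (auto simp: C_def)
  from Suc.IH[OF C this] obtain Q l where
    Q: "Q \<in> carrier_mat m m" "partial_unitary Q" "mat_adjoint Q * C * Q = real_diag m l" by auto
  \<comment> \<open>\<open>e\<close> is a diagonal entry of a Hermitian matrix, hence real; only so
    can it become an entry of \<open>real_diag\<close>.\<close>
  have Im: "e = complex_of_real (Re e)"
    using hermitian_matD[OF hB, of 0 0] B col0[of 0] by (auto simp: complex_eq_iff)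
  define E where "E = mat 1 1 (\<lambda>_. e)"
  have Beq: "B = four_block_mat E (0\<^sub>m 1 m) (0\<^sub>m m 1) C"
  proof (rule eq_matI, goal_cases)
    case (1 i j)
    then have ij: "i < Suc m" "j < Suc m" by (auto simp: C_def E_def)
    then show ?case
      using col0[of i] row0[of j] B
      by (auto simp: C_def E_def)
  qed (use B in \<open>auto simp: C_def E_def\<close>)
  \<comment> \<open>The diagonalizing matrix of the corner, extended by 1 so that the eigenvalue
    already split off stays in place.\<close>
  define F where "F = four_block_mat (1\<^sub>m 1) (0\<^sub>m 1 m) (0\<^sub>m m 1) Q"
  have F: "F \<in> carrier_mat (Suc m) (Suc m)" unfolding F_def using Q by (auto intro!: carrier_matI)
  have adF: "mat_adjoint F = four_block_mat (1\<^sub>m 1) (0\<^sub>m 1 m) (0\<^sub>m m 1) (mat_adjoint Q)"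
    unfolding F_def using Q by (intro eq_matI) auto
  have "mat_adjoint F * F = four_block_mat (1\<^sub>m 1) (0\<^sub>m 1 m) (0\<^sub>m m 1) (1\<^sub>m m)"
    unfolding adF unfolding F_def using Q
    by (subst mult_four_block_mat[of _ 1 1 _ m _ m _ _ 1 _ m]) (auto simp: partial_unitary_def)
  then have uF: "partial_unitary F" using F unfolding partial_unitary_def by simp
  have "mat_adjoint F * B = four_block_mat E (0\<^sub>m 1 m) (0\<^sub>m m 1) (mat_adjoint Q * C)"
    unfolding adF Beq using Q C
    by (subst mult_four_block_mat[of _ 1 1 _ m _ m _ _ 1 _ m]) (auto simp: E_def)
  then have "mat_adjoint F * B * F = four_block_mat E (0\<^sub>m 1 m) (0\<^sub>m m 1) (real_diag m l)"
    unfolding F_def using Q C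
    by (simp, subst mult_four_block_mat[of _ 1 1 _ m _ m _ _ 1 _ m]) (auto simp: E_def)
  also have "\<dots> = real_diag (Suc m) (case_nat (Re e) l)"
    by (rule eq_matI) (use Im in \<open>auto simp: E_def split: nat.splits\<close>)
  finally have "mat_adjoint (W * F) * H * (W * F) = real_diag (Suc m) (case_nat (Re e) l)"
    using W F Suc.prems unfolding B_def by (simp add: mat_adjoint_mult mult_mat_assoc)
  moreover have "partial_unitary (W * F)" using W F uF by (intro partial_unitary_mult) auto
  moreover have "W * F \<in> carrier_mat (Suc m) (Suc m)" using W F by simp
  ultimately show ?case by blast
qed

section \<open>Singular value decomposition\<close>

lemma mult_minus_mat:
  fixes A B C :: "'a :: ring mat"
  shows "dim_col A = dim_row B \<Longrightarrow> dim_row B = dim_row C \<Longrightarrow> dim_col B = dim_col C \<Longrightarrow>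
    A * (B - C) = A * B - A * C"
  by (rule mult_minus_distrib_mat[of _ "dim_row A" "dim_col A" _ "dim_col B"]) auto

lemma minus_mult_mat:
  fixes A B C :: "'a :: ring mat"
  shows "dim_col A = dim_row C \<Longrightarrow> dim_row A = dim_row B \<Longrightarrow> dim_col A = dim_col B \<Longrightarrow>
    (A - B) * C = A * C - B * C"
  by (rule minus_mult_distrib_mat[of _ "dim_row A" "dim_col A" _ _ "dim_col C"]) auto

lemma smult_mult_mat:
  fixes A B :: "'a :: comm_ring mat"
  shows "dim_col A = dim_row B \<Longrightarrow> (c \<cdot>\<^sub>m A) * B = c \<cdot>\<^sub>m (A * B)"
    "dim_col A = dim_row B \<Longrightarrow> A * (c \<cdot>\<^sub>m B) = c \<cdot>\<^sub>m (A * B)"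
  by (auto intro!: mult_smult_assoc_mat[of _ "dim_row A" "dim_col A" _ "dim_col B"]
      mult_smult_distrib[of _ "dim_row A" "dim_col A" _ "dim_col B"])

lemma index_mult_real_diag:
  assumes "i < dim_row A" "j < r" "dim_col A = r"
  shows "(A * real_diag r s) $$ (i, j) = A $$ (i, j) * complex_of_real (s j)"
  unfolding real_diag_def
  by (subst mat_diag_mult_right[of _ "dim_row A"]) (use assms in auto)

lemma index_real_diag_mult:
  assumes "i < r" "j < dim_col A" "dim_row A = r"
  shows "(real_diag r s * A) $$ (i, j) = complex_of_real (s i) * A $$ (i, j)"
  unfolding real_diag_def
  by (subst mat_diag_mult_left[of _ _ "dim_col A"]) (use assms in auto)

lemma real_diag_mult_real_diag: "real_diag r s * real_diag r t = real_diag r (\<lambda>j. s j * t j)"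
  by (simp add: real_diag_def)

lemma real_diag_cong: "(\<And>j. j < r \<Longrightarrow> s j = t j) \<Longrightarrow> real_diag r s = real_diag r t"
  by (rule eq_matI) auto

lemma real_diag_one: "real_diag r (\<lambda>_. 1) = 1\<^sub>m r"
  by (simp add: real_diag_def)

lemma partial_unitaryD: "partial_unitary M \<Longrightarrow> mat_adjoint M * M = 1\<^sub>m (dim_col M)"
  by (simp add: partial_unitary_def)

lemma partial_unitary_cancel:
  "partial_unitary M \<Longrightarrow> dim_row B = dim_col M \<Longrightarrow> mat_adjoint M * (M * B) = B"
  by (simp add: partial_unitaryD flip: mult_mat_assoc)

text \<open>Let W diagonalize the Gram matrix X^* X. The columns of Z = X W are then orthogonal with
  squared lengths \<open>l j\<close>; the nonzero ones, normalized, are the left singular vectors,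
  and the zero ones contribute nothing to X = Z W^*.\<close>

lemma reduced_svd_exists:
  assumes X: "X \<in> carrier_mat n q"
  shows "\<exists>r U s V. reduced_svd n q r X U s V"
proof -
  have "hermitian_mat (mat_adjoint X * X)" by (simp add: hermitian_mat_def mat_adjoint_mult)
  then obtain W l where W: "W \<in> carrier_mat q q" "partial_unitary W"
    and Wl: "mat_adjoint W * (mat_adjoint X * X) * W = real_diag q l"
    using hermitian_diagonalization[of "mat_adjoint X * X" q] mult_carrier_mat[OF mat_adjoint_carrier[OF X] X] by blast
  define Z where "Z = X * W"
  have Z: "Z \<in> carrier_mat n q" using X W by (simp add: Z_def)
  have ZZ: "mat_adjoint Z * Z = real_diag q l"
    using Wl W X by (simp add: Z_def mat_adjoint_mult mult_mat_assoc)
  have colZ: "col Z j \<bullet>c col Z i = (if i = j then of_real (l j) else 0)" if "i < q" "j < q" for i j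
    using that Z ZZ index_adjoint_mult[of i Z j Z] by simp
  \<comment> \<open>\<open>l j\<close> is a squared length, so it is zero as soon as it is not
    positive.\<close>
  have Z0: "Z $$ (a, j) = 0" if "a < n" "j < q" "\<not> 0 < l j" for a j
  proof -
    have "col Z j \<bullet>c col Z j \<ge> 0" by (rule conjugate_square_ge_0_vec)
    then have "l j = 0" using colZ[of j j] that by (simp add: less_eq_complex_def)
    then have "col Z j = 0\<^sub>v n" using colZ[of j j] that Z
      by (intro conjugate_square_eq_0_vec[of _ n, THEN iffD1]) auto
    then show ?thesis using that Z by (metis carrier_matD index_col index_zero_vec(1))
  qed
  define J where "J = filter (\<lambda>j. 0 < l j) [0..<q]"
  define r where "r = length J"
  have setJ: "set J = {j. j < q \<and> 0 < l j}" and dJ: "distinct J" by (auto simp: J_def)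
  have Jq: "J ! j < q" "0 < l (J ! j)" if "j < r" for j
    using setJ nth_mem[of j J] that unfolding r_def by auto
  have Jinj: "J ! i = J ! j \<longleftrightarrow> i = j" if "i < r" "j < r" for i j
    using dJ that nth_eq_iff_index_eq unfolding r_def by blast
  define s where "s j = sqrt (l (J ! j))" for j
  have s: "0 < s j" "s j * s j = l (J ! j)" if "j < r" for j using Jq[OF that] by (auto simp: s_def)
  define V where "V = mat q r (\<lambda>(i, j). W $$ (i, J ! j))"
  define U where "U = mat n r (\<lambda>(i, j). Z $$ (i, J ! j) / complex_of_real (s j))"
  have colV: "col V j = col W (J ! j)" if "j < r" for j
    by (rule eq_vecI) (use that W Jq in \<open>auto simp: V_def\<close>)
  have colU: "col U j = (1 / complex_of_real (s j)) \<cdot>\<^sub>v col Z (J ! j)" if "j < r" for j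
    by (rule eq_vecI) (use that Z Jq in \<open>auto simp: U_def\<close>)
  have "partial_unitary V"
  proof -
    have "dim_col V = r" by (simp add: V_def)
    then show ?thesis using W Jq Jinj unfolding partial_unitary_iff by (auto simp: colV)
  qed
  moreover have "partial_unitary U"
    unfolding partial_unitary_iff
  proof (intro allI impI)
    fix i j assume "i < dim_col U" "j < dim_col U"
    then have ij: "i < r" "j < r" by (auto simp: U_def)
    have c: "col Z (J ! i) \<in> carrier_vec n" "col Z (J ! j) \<in> carrier_vec n" using Z Jq ij by auto
    have "col U j \<bullet>c col U i = 1 / of_real (s j) * (1 / of_real (s i)) * (col Z (J ! j) \<bullet>c col Z (J ! i))"
      using c[THEN carrier_vecD] by (simp add: colU ij conjugate_smult_vec scalar_prod_def sum_distrib_left mult_ac)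
    then show "col U j \<bullet>c col U i = (if i = j then 1 else 0)"
      using colZ[OF Jq(1)[OF ij(1)] Jq(1)[OF ij(2)]] s[OF ij(1)] Jinj[OF ij]
      by (auto simp flip: of_real_mult)
  qed
  moreover have "X = U * real_diag r s * mat_adjoint V"
  proof (rule eq_matI, goal_cases)
    case (1 a b)
    then have ab: "a < n" "b < q" by (auto simp: U_def V_def)
    have "(U * real_diag r s * mat_adjoint V) $$ (a, b) =
        (\<Sum>j<r. Z $$ (a, J ! j) * cnj (W $$ (b, J ! j)))"
      using ab by (subst index_mult_mat_sum)
        (auto simp: U_def V_def index_mult_real_diag simp del: index_mult_mat(1) intro!: sum.cong dest: s(1))
    also have "\<dots> = (\<Sum>j\<in>set J. Z $$ (a, j) * cnj (W $$ (b, j)))"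
      using bij_betw_nth[OF dJ refl refl] by (intro sum.reindex_bij_betw) (simp add: r_def)
    also have "\<dots> = (\<Sum>j<q. Z $$ (a, j) * cnj (W $$ (b, j)))"
      using Z0 ab by (intro sum.mono_neutral_left) (auto simp: setJ)
    also have "\<dots> = (Z * mat_adjoint W) $$ (a, b)"
      using ab Z W by (subst index_mult_mat_sum) auto
    also have "Z * mat_adjoint W = X"
      using X W partial_unitary_square[OF W] by (simp add: Z_def mult_mat_assoc)
    finally show ?case by simp
  qed (use X in \<open>auto simp: U_def V_def\<close>)
  moreover have "U \<in> carrier_mat n r" "V \<in> carrier_mat q r" by (auto simp: U_def V_def)
  ultimately show ?thesis using X s(1) unfolding reduced_svd_def by blast
qed

text \<open>Each of the two matrices is a right multiple of the other, so their column spaces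
  coincide.\<close>

lemma rank_mult_right_eq:
  fixes X U :: "complex mat"
  assumes "X \<in> carrier_mat n q" "U \<in> carrier_mat n r" "R \<in> carrier_mat r q" "T \<in> carrier_mat q r"
    and "X = U * R" "U = X * T"
  shows "vec_space.rank n X = vec_space.rank n U"
proof -
  interpret vec_space "TYPE(complex)" n .
  have sub: "col_space (N * K) \<subseteq> col_space N" if "N \<in> carrier_mat n a" "K \<in> carrier_mat a b"
    for N K :: "complex mat" and a b
  proof
    note NK = mult_carrier_mat[OF that]
    fix y assume "y \<in> col_space (N * K)"
    with col_space_eq[OF NK] that obtain x where "x \<in> carrier_vec b" "N * K *\<^sub>v x = y" "y \<in> carrier_vec n"
      by auto
    moreover from this have "N *\<^sub>v (K *\<^sub>v x) = y"
      using that assoc_mult_mat_vec[of N n a K b x] by simp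
    moreover have "K *\<^sub>v x \<in> carrier_vec (dim_col N)" using that by (simp add: carrier_vecI)
    ultimately show "y \<in> col_space N"
      using that unfolding col_space_eq[OF that(1)] by auto
  qed
  have "col_space X = col_space U"
    using sub[OF assms(1,4)] sub[OF assms(2,3)] unfolding assms(5,6)[symmetric] by blast
  then show ?thesis unfolding rank_def col_space_def by simp
qed

lemma partial_unitary_rank:
  assumes U: "U \<in> carrier_mat n r" "partial_unitary U"
  shows "vec_space.rank n U = r"
proof -
  interpret vec_space "TYPE(complex)" n .
  have dist: "distinct (cols U)"
    using U unfolding distinct_conv_nth partial_unitary_iff
    by (metis carrier_matD(2) cols_length cols_nth zero_neq_one)
  have "lin_indpt (set (cols U))"
  proof
    assume "lin_dep (set (cols U))"
    from lin_depE[OF U(1) this dist] obtain v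
      where v: "v \<in> carrier_vec r" "v \<noteq> 0\<^sub>v r" "U *\<^sub>v v = 0\<^sub>v n" .
    have "v = (mat_adjoint U * U) *\<^sub>v v" using U v by (simp add: partial_unitary_def)
    also have "\<dots> = mat_adjoint U *\<^sub>v (U *\<^sub>v v)"
      using U v by (intro assoc_mult_mat_vec[of _ r n _ r]) auto
    also have "\<dots> = 0\<^sub>v r" using U v(3) by (auto intro!: eq_vecI)
    finally show False using v(2) by simp
  qed
  then show ?thesis using lin_indpt_full_rank[OF U(1) dist] by blast
qed

text \<open>The second identity recovers U as a right multiple of X. Through it, what S and
  \<open>stat_op A S\<close> do to X from the left carries over to the left singular
  vectors.\<close>

lemma reduced_svd_mult_right:
  assumes "reduced_svd n q r X U s V"
  shows "X * V = U * real_diag r s" "X * (V * real_diag r (\<lambda>j. inverse (s j))) = U"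
proof -
  have d: "U \<in> carrier_mat n r" "V \<in> carrier_mat q r" "partial_unitary V" "X = U * real_diag r s * mat_adjoint V"
    and s: "\<And>j. j < r \<Longrightarrow> 0 < s j"
    using assms by (auto simp: reduced_svd_def)
  show XV: "X * V = U * real_diag r s"
    using d by (simp add: mult_mat_assoc partial_unitaryD)
  have "real_diag r s * real_diag r (\<lambda>j. inverse (s j)) = 1\<^sub>m r"
    using s unfolding real_diag_mult_real_diag real_diag_one[symmetric]
    by (intro real_diag_cong) (metis less_irrefl right_inverse)
  moreover have "X * (V * real_diag r (\<lambda>j. inverse (s j))) = X * V * real_diag r (\<lambda>j. inverse (s j))"
    using d by (subst mult_mat_assoc) auto
  ultimately show "X * (V * real_diag r (\<lambda>j. inverse (s j))) = U"
    using d unfolding XV by (simp add: mult_mat_assoc)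
qed

lemma reduced_svd_rank:
  assumes "reduced_svd n q r X U s V"
  shows "vec_space.rank n X = r"
proof -
  have d: "X \<in> carrier_mat n q" "U \<in> carrier_mat n r" "V \<in> carrier_mat q r" "partial_unitary U"
    "X = U * real_diag r s * mat_adjoint V"
    using assms by (auto simp: reduced_svd_def)
  have "X = U * (real_diag r s * mat_adjoint V)" using d by (simp add: mult_mat_assoc)
  then have "vec_space.rank n X = vec_space.rank n U"
    using reduced_svd_mult_right(2)[OF assms, symmetric] d(1,2)
    by (rule rank_mult_right_eq[rotated 4]) (use d(3) in auto)
  then show ?thesis using partial_unitary_rank[of U n r] d by simp
qed

section \<open>The Hermitian matrix of the first-order condition\<close>

text \<open>With S = X X^*, the first-order condition reads
  \<open>stat_op A S * X + X * real_diag p d = 0\<close>. S stays a parameter: it belongs to the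
  whole matrix, while the products are taken with a single block or its singular vectors.\<close>

definition stat_op :: "complex mat \<Rightarrow> complex mat \<Rightarrow> complex mat" where
  "stat_op A S = 2 \<cdot>\<^sub>m A - A * S - S * A"

lemma stat_op_carrier [simp]:
  "A \<in> carrier_mat n n \<Longrightarrow> S \<in> carrier_mat n n \<Longrightarrow> stat_op A S \<in> carrier_mat n n"
  unfolding stat_op_def by (auto intro: minus_carrier_mat)

lemma stat_op_mult:
  assumes "A \<in> carrier_mat n n" "S \<in> carrier_mat n n" "dim_row T = n"
  shows "stat_op A S * T = 2 \<cdot>\<^sub>m (A * T) - A * (S * T) - S * (A * T)"
  using assms unfolding stat_op_def by (simp add: minus_mult_mat smult_mult_mat mult_mat_assoc)

lemma hermitian_stat_op:
  assumes A: "A \<in> carrier_mat n n" and S: "S \<in> carrier_mat n n" and h: "hermitian_mat A" "hermitian_mat S"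
  shows "hermitian_mat (stat_op A S)"
proof -
  have "mat_adjoint (A * S) = S * A" "mat_adjoint (S * A) = A * S"
    using A S h unfolding hermitian_mat_def by (auto simp: mat_adjoint_mult)
  then have e: "(S * A) $$ (i, j) = cnj ((A * S) $$ (j, i))" "(A * S) $$ (i, j) = cnj ((S * A) $$ (j, i))"
    if "i < n" "j < n" for i j
    using that A S index_mat_adjoint[of i "A * S" j] index_mat_adjoint[of i "S * A" j]
    by (auto simp del: index_mult_mat(1))
  show ?thesis
    unfolding hermitian_mat_def
  proof (rule eq_matI, goal_cases)
    case (1 i j)
    then have ij: "i < n" "j < n" using A S by (auto simp: stat_op_def)
    then show ?case
      using A S e(1)[OF ij] e(2)[OF ij] hermitian_matD[OF h(1), of i j]
      by (simp add: stat_op_def del: index_mult_mat(1))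
  qed (use A S in \<open>auto simp: stat_op_def\<close>)
qed

text \<open>S multiplies the columns of U by their eigenvalues and, being Hermitian, does the same
  to the rows of U'^* from the other side; both terms with S thus become scalar factors entry by
  entry. U' = U gives the equations inside a block, U' from another block those between
  blocks.\<close>

lemma stat_op_sandwich:
  assumes A: "A \<in> carrier_mat n n" and S: "S \<in> carrier_mat n n" "hermitian_mat S"
    and U: "U \<in> carrier_mat n r" "S * U = U * real_diag r t"
    and U': "U' \<in> carrier_mat n r'" "S * U' = U' * real_diag r' t'"
    and kj: "k < r'" "j < r"
  shows "(mat_adjoint U' * (stat_op A S * U)) $$ (k, j) =
    (2 - of_real (t j) - of_real (t' k)) * (mat_adjoint U' * A * U) $$ (k, j)"
proof -
  let ?B = "mat_adjoint U' * (A * U)"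
  have "mat_adjoint U' * S = mat_adjoint (S * U')"
    using S U'(1) unfolding hermitian_mat_def by (simp add: mat_adjoint_mult)
  also have "\<dots> = real_diag r' t' * mat_adjoint U'"
    unfolding U'(2) using U'(1) by (simp add: mat_adjoint_mult)
  finally have "mat_adjoint U' * S * (A * U) = real_diag r' t' * mat_adjoint U' * (A * U)" by simp
  then have "mat_adjoint U' * (S * (A * U)) = real_diag r' t' * ?B"
    using S(1) U'(1) U(1) A by (simp add: mult_mat_assoc)
  moreover have "mat_adjoint U' * (A * (S * U)) = ?B * real_diag r t"
    using U'(1) U(1) A unfolding U(2) by (simp add: mult_mat_assoc)
  ultimately have "mat_adjoint U' * (stat_op A S * U) = 2 \<cdot>\<^sub>m ?B - ?B * real_diag r t - real_diag r' t' * ?B"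
    using A S U(1) U'(1) by (simp add: stat_op_mult mult_minus_mat smult_mult_mat)
  moreover have "mat_adjoint U' * A * U = ?B" using A U(1) U'(1) by (simp add: mult_mat_assoc)
  ultimately show ?thesis
    using A S U(1) U'(1) kj
    by (simp add: index_mult_real_diag index_real_diag_mult algebra_simps del: index_mult_mat(1))
qed

section \<open>A single block: negative diagonal entries, the trace identity, singular
  values\<close>

lemma partial_unitary_col_nonzero:
  assumes "U \<in> carrier_mat n r" "partial_unitary U" "j < r"
  shows "col U j \<noteq> 0\<^sub>v n"
  using assms unfolding partial_unitary_iff
  by (metis carrier_matD(2) col_carrier_vec conjugate_square_eq_0_vec zero_neq_one)

lemma diag_entry_eq:
  assumes "A \<in> carrier_mat n n" "hermitian_mat A" "U \<in> carrier_mat n r" "j < r"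
  shows "(mat_adjoint U * A * U) $$ (j, j) = of_real (diag_entry A U j)"
proof -
  have "hermitian_mat (mat_adjoint U * A * U)" using assms by (intro hermitian_mat_conj) auto
  from hermitian_matD[OF this, of j j] show ?thesis
    using assms by (simp add: diag_entry_def complex_eq_iff del: index_mult_mat(1))
qed

text \<open>Negative definiteness acts through this fact: every sign argument about multipliers and
  singular values rests on it.\<close>

lemma diag_entry_neg:
  assumes A: "negative_definite_mat n A" and U: "U \<in> carrier_mat n r" "partial_unitary U" and j: "j < r"
  shows "diag_entry A U j < 0"
proof -
  have A': "A \<in> carrier_mat n n" using A by (simp add: negative_definite_mat_def)
  have "col U j \<noteq> 0\<^sub>v n" by (rule partial_unitary_col_nonzero[OF U j])
  moreover have "(mat_adjoint U * A * U) $$ (j, j) = (A *\<^sub>v col U j) \<bullet>c col U j"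
    by (rule index_adjoint_sandwich[OF A' U(1,1) j j])
  ultimately show ?thesis
    using A U j unfolding negative_definite_mat_def diag_entry_def by auto
qed

lemma svd_gram_diag:
  assumes d: "U \<in> carrier_mat n r" "V \<in> carrier_mat q r" "partial_unitary U"
    and X: "X = U * real_diag r s * mat_adjoint V" and i: "i < q"
  shows "(mat_adjoint X * X) $$ (i, i) = (\<Sum>j<r. complex_of_real ((s j)\<^sup>2) * (cnj (V $$ (i, j)) * V $$ (i, j)))"
proof -
  have "mat_adjoint X * X = V * (real_diag r s * (mat_adjoint U * (U * (real_diag r s * mat_adjoint V))))"
    using d(1,2) unfolding X by (simp add: mat_adjoint_mult mult_mat_assoc)
  also have "\<dots> = V * (real_diag r s * (real_diag r s * mat_adjoint V))"
    using d by (simp add: partial_unitary_cancel)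
  also have "\<dots> = V * real_diag r (\<lambda>j. s j * s j) * mat_adjoint V"
    using d(2) by (simp add: mult_mat_assoc flip: real_diag_mult_real_diag)
  finally show ?thesis
    using d(2) i by (simp only:, subst index_mult_mat_sum)
      (auto simp: index_mult_real_diag power2_eq_square mult_ac simp del: index_mult_mat(1) intro!: sum.cong)
qed

text \<open>Both sides are the trace of X^* X: the eigenvalues s^2 on the left, q unit columns on
  the right.\<close>

lemma sum_singular_values:
  assumes X: "reduced_svd n q r X U s V" and ob: "X \<in> oblique_manifold n q"
  shows "(\<Sum>j<r. (s j)\<^sup>2) = real q"
proof -
  have d: "U \<in> carrier_mat n r" "V \<in> carrier_mat q r" "partial_unitary U"
    "partial_unitary V" "X = U * real_diag r s * mat_adjoint V"
    using X by (auto simp: reduced_svd_def)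
  have "complex_of_real q = (\<Sum>i<q. (mat_adjoint X * X) $$ (i, i))"
    using ob by (simp add: oblique_manifold_def del: index_mult_mat(1))
  also have "\<dots> = (\<Sum>i<q. \<Sum>j<r. complex_of_real ((s j)\<^sup>2) * (cnj (V $$ (i, j)) * V $$ (i, j)))"
    using svd_gram_diag[OF d(1-3,5)] by (intro sum.cong refl) simp
  also have "\<dots> = (\<Sum>j<r. of_real ((s j)\<^sup>2) * (\<Sum>i<q. cnj (V $$ (i, j)) * V $$ (i, j)))"
    by (subst sum.swap) (simp add: sum_distrib_left)
  also have "\<dots> = (\<Sum>j<r. of_real ((s j)\<^sup>2) * (mat_adjoint V * V) $$ (j, j))"
    using d(2) by (intro sum.cong refl) (simp add: index_mult_mat_sum del: index_mult_mat(1))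
  also have "\<dots> = of_real (\<Sum>j<r. (s j)\<^sup>2)"
    using d(2,4) by (simp add: partial_unitaryD del: index_mult_mat(1))
  finally show ?thesis by (metis of_real_eq_iff of_real_of_nat_eq)
qed

text \<open>All of this holds for an arbitrary SVD of the block, before U is adapted to A, since
  only the diagonal entries of U^* A U enter the formula and the sign of \<open>\<delta>\<close>. S
  comes from the full matrix; \<open>SX\<close> is what remains of S X when the other blocks are
  orthogonal to X.\<close>

lemma svd_block_basic:
  assumes A: "negative_definite_mat n A" and S: "S \<in> carrier_mat n n" "hermitian_mat S"
    and ob: "X \<in> oblique_manifold n q" and q: "1 \<le> q"
    and SX: "S * X = X * (mat_adjoint X * X)"
    and MX: "stat_op A S * X = complex_of_real (-\<delta>) \<cdot>\<^sub>m X"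
    and svd: "reduced_svd n q r X U s V"
  shows "S * U = U * real_diag r (\<lambda>j. (s j)\<^sup>2)"
    and "stat_op A S * U = complex_of_real (-\<delta>) \<cdot>\<^sub>m U"
    and "k < r \<Longrightarrow> j < r \<Longrightarrow> k \<noteq> j \<Longrightarrow>
      (2 - (s j)\<^sup>2 - (s k)\<^sup>2 = 0 \<or> (mat_adjoint U * A * U) $$ (k, j) = 0)"
    and "j < r \<Longrightarrow> s j = sigma_formula A q r U j"
    and "j < r \<Longrightarrow> 1 \<le> s j"
    and "\<delta> = 0 \<longleftrightarrow> r = q"
    and "\<delta> = 0 \<Longrightarrow> j < r \<Longrightarrow> s j = 1"
    and "\<delta> \<noteq> 0 \<Longrightarrow> j < r \<Longrightarrow> 1 < s j"
proof -
  have A': "A \<in> carrier_mat n n" "hermitian_mat A" using A by (auto simp: negative_definite_mat_def)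
  have d: "X \<in> carrier_mat n q" "U \<in> carrier_mat n r" "V \<in> carrier_mat q r" "partial_unitary U"
    "partial_unitary V" "X = U * real_diag r s * mat_adjoint V" and s: "\<And>j. j < r \<Longrightarrow> 0 < s j"
    using svd by (auto simp: reduced_svd_def)
  note XV = reduced_svd_mult_right[OF svd]
  let ?R = "real_diag r (\<lambda>j. inverse (s j))"
  let ?T = "real_diag r (\<lambda>j. (s j)\<^sup>2)"
  have "mat_adjoint X * U = V * real_diag r s"
    using d(2-5) unfolding d(6) by (simp add: mat_adjoint_mult mult_mat_assoc partial_unitaryD)
  then have XXU: "X * (mat_adjoint X * U) = U * ?T"
    using d(1-3) XV(1) by (simp add: real_diag_mult_real_diag power2_eq_square mult_mat_assoc flip: mult_mat_assoc[of X V])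
  show SU: "S * U = U * ?T"
  proof -
    have "S * U = S * X * (V * ?R)"
      using S d(1,3) by (subst XV(2)[symmetric]) (simp add: mult_mat_assoc)
    also have "\<dots> = X * (mat_adjoint X * (X * (V * ?R)))"
      unfolding SX using d(1,3) by (simp add: mult_mat_assoc)
    finally show ?thesis unfolding XV(2) XXU .
  qed
  show MU: "stat_op A S * U = complex_of_real (-\<delta>) \<cdot>\<^sub>m U"
  proof -
    have "stat_op A S * U = stat_op A S * X * (V * ?R)"
      using stat_op_carrier[OF A'(1) S(1)] d(1,3) by (subst XV(2)[symmetric]) (simp add: mult_mat_assoc)
    also have "\<dots> = complex_of_real (-\<delta>) \<cdot>\<^sub>m (X * (V * ?R))"
      unfolding MX using d(1,3) by (simp add: smult_mult_mat)
    finally show ?thesis unfolding XV(2) .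
  qed
  let ?a = "diag_entry A U"
  \<comment> \<open>U^* M U is evaluated twice: by \<open>stat_op_sandwich\<close>, and from M U =
    -\<delta> U together with U^* U = I.\<close>
  have B: "(2 - of_real ((s j)\<^sup>2) - of_real ((s k)\<^sup>2)) * (mat_adjoint U * A * U) $$ (k, j) =
      (if k = j then - complex_of_real \<delta> else 0)" if "k < r" "j < r" for k j
    using stat_op_sandwich[OF A'(1) S d(2) SU d(2) SU that] that d(2,4)
    unfolding MU by (cases "k = j") (auto simp: smult_mult_mat partial_unitaryD simp del: index_mult_mat(1))
  show "k < r \<Longrightarrow> j < r \<Longrightarrow> k \<noteq> j \<Longrightarrow>
      (2 - (s j)\<^sup>2 - (s k)\<^sup>2 = 0 \<or> (mat_adjoint U * A * U) $$ (k, j) = 0)"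
  proof -
    assume "k < r" "j < r" "k \<noteq> j"
    then have "complex_of_real (2 - (s j)\<^sup>2 - (s k)\<^sup>2) * (mat_adjoint U * A * U) $$ (k, j) = 0"
      using B[of k j] by (simp del: index_mult_mat(1))
    then show ?thesis unfolding mult_eq_0_iff of_real_eq_0_iff .
  qed
  have aneg: "?a j < 0" if "j < r" for j by (rule diag_entry_neg[OF A d(2,4) that])
  have diag: "2 * (1 - (s j)\<^sup>2) * ?a j = - \<delta>" if "j < r" for j
  proof -
    have "complex_of_real ((2 - (s j)\<^sup>2 - (s j)\<^sup>2) * ?a j) = of_real (- \<delta>)"
      using B[OF that that] diag_entry_eq[OF A' d(2) that] by (simp del: index_mult_mat(1))
    then show ?thesis unfolding of_real_eq_iff by (simp add: algebra_simps)
  qed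
  have s2: "(s j)\<^sup>2 = 1 + \<delta> / 2 * (1 / ?a j)" if "j < r" for j
    using diag[OF that] aneg[OF that] by (simp add: field_simps)
  define Q where "Q = (\<Sum>l<r. 1 / ?a l)"
  \<comment> \<open>The trace q of the Gram matrix turns the separate formulas for the singular
    values into one equation for \<open>\<delta>\<close>.\<close>
  have "real q = (\<Sum>j<r. 1 + \<delta> / 2 * (1 / ?a j))"
    using sum_singular_values[OF svd ob] s2 by simp
  then have tr: "\<delta> / 2 * Q = real q - real r"
    unfolding Q_def by (simp add: sum.distrib sum_distrib_left)
  have r0: "r > 0" using sum_singular_values[OF svd ob] q by (cases r) auto
  have Q: "Q < 0"
    using sum_strict_mono[of "{..<r}" "\<lambda>l. 1 / ?a l" "\<lambda>_. 0"] aneg r0 by (auto simp: Q_def)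
  \<comment> \<open>The rank is at most the number of columns. With \<open>Q < 0\<close> this makes
    \<open>\<delta>\<close> nonpositive, which is the source of \<open>1 \<le> s j\<close>.\<close>
  have rq: "r \<le> q"
    using partial_unitary_rank[OF d(3,5)] vec_space.rank_le_nc[OF d(1)] reduced_svd_rank[OF svd] by simp
  have delta: "\<delta> / 2 = (real q - real r) / Q" using tr Q by (simp add: field_simps)
  show "\<delta> = 0 \<longleftrightarrow> r = q" using delta Q by auto
  have dle: "\<delta> \<le> 0" using delta Q rq by (simp add: divide_nonneg_neg)
  have formula: "(s j)\<^sup>2 = 1 + (real q - real r) / (?a j * Q)" if "j < r" for j
    unfolding s2[OF that] delta using Q aneg[OF that] by (simp add: field_simps)
  show "s j = sigma_formula A q r U j" if "j < r"
    unfolding sigma_formula_def Q_def[symmetric] formula[OF that, symmetric] using s[OF that] by simp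
  show "1 \<le> s j" if "j < r"
  proof -
    have "(s j)\<^sup>2 \<ge> 1\<^sup>2" using s2[OF that] dle aneg[OF that] by (simp add: divide_nonpos_neg)
    then show ?thesis using s[OF that] by (rule power2_le_imp_le[OF _ less_imp_le])
  qed
  show "s j = 1" if "\<delta> = 0" "j < r"
    using s2[OF that(2)] s[OF that(2)] that(1) by (simp add: power2_eq_1_iff)
  show "1 < s j" if "\<delta> \<noteq> 0" "j < r"
  proof -
    have "\<delta> / 2 * (1 / ?a j) > 0" using that dle aneg[OF that(2)] by (simp add: divide_neg_neg)
    then have "(s j)\<^sup>2 > 1\<^sup>2" using s2[OF that(2)] by simp
    then show ?thesis using s[OF that(2)] by (rule power_less_imp_less_base[OF _ less_imp_le])
  qed
qed

text \<open>For nonzero \<open>\<delta>\<close> any SVD will do, because all singular values exceed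
  1 and 2 - s^2 - s'^2 is negative. For \<open>\<delta> = 0\<close> the singular value matrix is I,
  so X = (U W) (V W)^* for every unitary W, and W is chosen to diagonalize U^* A U.\<close>

lemma svd_block:
  assumes A: "negative_definite_mat n A" and S: "S \<in> carrier_mat n n" "hermitian_mat S"
    and ob: "X \<in> oblique_manifold n q" and q: "1 \<le> q"
    and SX: "S * X = X * (mat_adjoint X * X)"
    and MX: "stat_op A S * X = complex_of_real (-\<delta>) \<cdot>\<^sub>m X"
  obtains r U s V where "reduced_svd n q r X U s V" "diagonal_mat (mat_adjoint U * A * U)"
    "\<delta> = 0 \<Longrightarrow> X = U * mat_adjoint V"
proof -
  obtain r U s V where svd: "reduced_svd n q r X U s V"
    using reduced_svd_exists[of X n q] ob by (auto simp: oblique_manifold_def)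
  note basic = svd_block_basic[OF A S ob q SX MX svd]
  have A': "A \<in> carrier_mat n n" "hermitian_mat A" using A by (auto simp: negative_definite_mat_def)
  have d: "X \<in> carrier_mat n q" "U \<in> carrier_mat n r" "V \<in> carrier_mat q r" "partial_unitary U"
    "partial_unitary V" "X = U * real_diag r s * mat_adjoint V"
    using svd by (auto simp: reduced_svd_def)
  show thesis
  proof (cases "\<delta> = 0")
    case False
    have "(mat_adjoint U * A * U) $$ (k, j) = 0" if "k < r" "j < r" "k \<noteq> j" for k j
    proof -
      have "1 < s j" "1 < s k" using basic(8)[OF False] that by auto
      then have "(s j)\<^sup>2 > 1" "(s k)\<^sup>2 > 1" by (auto intro: one_less_power)
      then show ?thesis using basic(3)[OF that] by linarith
    qed
    then have "diagonal_mat (mat_adjoint U * A * U)" using d A' by (simp add: diagonal_mat_def del: index_mult_mat(1))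
    then show thesis using that[OF svd] False by blast
  next
    case True
    have "real_diag r s = 1\<^sub>m r" using basic(7)[OF True] real_diag_cong[of r s "\<lambda>_. 1"] by (simp add: real_diag_one)
    then have XUV: "X = U * mat_adjoint V" using d by simp
    have "hermitian_mat (mat_adjoint U * A * U)" using d(2) A' by (intro hermitian_mat_conj) auto
    moreover have "mat_adjoint U * A * U \<in> carrier_mat r r" using d(2) A'(1) by (intro carrier_matI) auto
    ultimately obtain W l where W: "W \<in> carrier_mat r r" "partial_unitary W"
      "mat_adjoint W * (mat_adjoint U * A * U) * W = real_diag r l"
      using hermitian_diagonalization by blast
    have WW: "W * (mat_adjoint W * Z) = Z" if "dim_row Z = r" for Z
      using partial_unitary_square[OF W(1,2)] that W(1) by (simp flip: mult_mat_assoc)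
    have X2: "X = U * W * mat_adjoint (V * W)"
      unfolding XUV using d(2,3) W(1) by (simp add: mat_adjoint_mult mult_mat_assoc WW)
    have UW: "U * W \<in> carrier_mat n r" and VW: "V * W \<in> carrier_mat q r" using d(2,3) W(1) by auto
    have "partial_unitary (U * W)" "partial_unitary (V * W)"
      using d(2-5) W(1,2) by (auto intro!: partial_unitary_mult)
    moreover have "X = U * W * real_diag r (\<lambda>_. 1) * mat_adjoint (V * W)"
      unfolding real_diag_one right_mult_one_mat[OF UW] by (rule X2)
    ultimately have svd': "reduced_svd n q r X (U * W) (\<lambda>_. 1) (V * W)"
      using d(1) UW VW unfolding reduced_svd_def
      by (intro conjI allI impI) (assumption | simp only: zero_less_one)+
    have "mat_adjoint (U * W) * A * (U * W) = mat_adjoint W * (mat_adjoint U * A * U) * W"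
      using W(1) d(2) A'(1) by (simp add: mat_adjoint_mult mult_mat_assoc)
    then have "diagonal_mat (mat_adjoint (U * W) * A * (U * W))"
      unfolding W(3) by (simp add: diagonal_mat_def)
    then show thesis using that[OF svd' _ X2] by blast
  qed
qed

section \<open>Existence of the right singular vectors\<close>

lemma nth_root_unity_distinct:
  fixes q i j :: nat
  assumes "i < q" "j < q" "i \<noteq> j"
  shows "cis (2 * pi * real i / real q) \<noteq> cis (2 * pi * real j / real q)"
  using bij_betw_roots_unity[of q] assms unfolding bij_betw_def inj_on_def by auto

text \<open>The inner product of columns j and m is 1/q times a geometric sum of powers of
  \<open>cnj (w j) * w m\<close>. This ratio is a q-th root of unity, different from 1 for distinct
  columns, so the sum vanishes.\<close>

lemma exists_flat_partial_unitary:
  assumes "r \<le> q" "0 < q"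
  shows "\<exists>V \<in> carrier_mat q r. partial_unitary V \<and> (\<forall>i<q. \<forall>j<r. cnj (V $$ (i, j)) * V $$ (i, j) = 1 / of_nat q)"
proof -
  define w where "w j = cis (2 * pi * real j / real q)" for j
  define V where "V = mat q r (\<lambda>(i, j). w j ^ i / of_real (sqrt (real q)))"
  have V: "V \<in> carrier_mat q r" by (simp add: V_def)
  have sq: "complex_of_real (sqrt (real q)) * of_real (sqrt (real q)) = of_nat q"
    by (simp flip: of_real_mult)
  have ww: "cnj (w j) * w j = 1" for j by (simp add: w_def cis_cnj flip: cis_inverse)
  have wq: "w j ^ q = 1" for j
  proof -
    have "w j ^ q = cis (2 * pi) ^ j" using assms unfolding w_def DeMoivre by (simp add: mult_ac)
    then show ?thesis by simp
  qed
  have VV: "cnj (V $$ (i, j)) * V $$ (i, m) = (cnj (w j) * w m) ^ i / of_nat q" if "i < q" "j < r" "m < r" for i j m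
    using that sq by (simp add: V_def power_mult_distrib)
  have "mat_adjoint V * V = 1\<^sub>m r"
  proof (rule eq_matI, goal_cases)
    case (1 j m)
    then have jm: "j < r" "m < r" by auto
    have "(mat_adjoint V * V) $$ (j, m) = (\<Sum>i<q. cnj (V $$ (i, j)) * V $$ (i, m))"
      using jm V by (subst index_mult_mat_sum) auto
    also have "\<dots> = (\<Sum>i<q. (cnj (w j) * w m) ^ i) / of_nat q"
      unfolding sum_divide_distrib using VV jm by (intro sum.cong) auto
    also have "\<dots> = (if j = m then 1 else 0)"
    proof (cases "j = m")
      case True
      then show ?thesis using ww assms by simp
    next
      case False
      have "cnj (w j) * w m \<noteq> 1"
      proof
        assume "cnj (w j) * w m = 1"
        then have "w j = w j * cnj (w j) * w m" by (simp add: mult.assoc)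
        also have "\<dots> = w m" using ww[of j] by (simp add: mult.commute)
        finally show False using nth_root_unity_distinct[of j q m] jm assms False by (auto simp: w_def)
      qed
      moreover have "(cnj (w j) * w m) ^ q = 1"
        using wq by (simp add: power_mult_distrib flip: complex_cnj_power)
      ultimately show ?thesis using False geometric_sum[of "cnj (w j) * w m" q] by simp
    qed
    finally show ?case using jm by simp
  qed (use V in auto)
  then show ?thesis using V VV ww by (intro bexI[of _ V]) (auto simp: partial_unitary_def)
qed

text \<open>If all entries of V have squared modulus 1/q, each diagonal entry of X^* X is the sum of
  the s_j^2 divided by q. The formula for the singular values makes that sum equal to q, so every
  column has length 1.\<close>

lemma right_singular_vectors_exist:
  assumes A: "negative_definite_mat n A" and r: "1 \<le> r" "r \<le> q"
    and U: "U \<in> carrier_mat n r" "partial_unitary U"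
  shows "\<exists>V \<in> carrier_mat q r. partial_unitary V \<and>
      U * real_diag r (sigma_formula A q r U) * mat_adjoint V \<in> oblique_manifold n q"
proof -
  obtain V where V: "V \<in> carrier_mat q r" "partial_unitary V"
    and flat: "\<And>i j. i < q \<Longrightarrow> j < r \<Longrightarrow> cnj (V $$ (i, j)) * V $$ (i, j) = 1 / of_nat q"
    using exists_flat_partial_unitary[OF r(2)] r by auto
  let ?a = "diag_entry A U"
  let ?s = "sigma_formula A q r U"
  define Q where "Q = (\<Sum>l<r. 1 / ?a l)"
  have aneg: "?a j < 0" if "j < r" for j by (rule diag_entry_neg[OF A U that])
  have Q: "Q < 0"
    using sum_strict_mono[of "{..<r}" "\<lambda>l. 1 / ?a l" "\<lambda>_. 0"] aneg r by (auto simp: Q_def lessThan_empty_iff)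
  have s2: "(?s j)\<^sup>2 = 1 + (real q - real r) / Q * (1 / ?a j)" if "j < r" for j
  proof -
    have "0 \<le> (real q - real r) / (?a j * Q)"
      using aneg[OF that] Q r by (intro divide_nonneg_nonneg) (auto intro: mult_nonpos_nonpos)
    then show ?thesis by (simp add: sigma_formula_def Q_def[symmetric] mult.commute)
  qed
  have "(\<Sum>j<r. (?s j)\<^sup>2) = (\<Sum>j<r. 1 + (real q - real r) / Q * (1 / ?a j))"
    using s2 by simp
  also have "\<dots> = real r + (real q - real r) / Q * Q"
    unfolding Q_def by (simp add: sum.distrib sum_distrib_left)
  also have "\<dots> = real q" using Q by simp
  finally have total: "(\<Sum>j<r. (?s j)\<^sup>2) = real q" .
  let ?X = "U * real_diag r ?s * mat_adjoint V"
  have "(mat_adjoint ?X * ?X) $$ (i, i) = 1" if i: "i < q" for i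
  proof -
    have "(mat_adjoint ?X * ?X) $$ (i, i) = (\<Sum>j<r. complex_of_real ((?s j)\<^sup>2) * (1 / of_nat q))"
      using svd_gram_diag[OF U(1) V(1) U(2) refl i, of ?s] flat[OF i] by (simp del: index_mult_mat(1))
    also have "\<dots> = complex_of_real (\<Sum>j<r. (?s j)\<^sup>2) / of_nat q"
      by (simp add: sum_divide_distrib)
    also have "\<dots> = 1" unfolding total using r by simp
    finally show ?thesis .
  qed
  moreover have "?X \<in> carrier_mat n q" using U V by (intro carrier_matI) auto
  ultimately show ?thesis using V by (auto simp: oblique_manifold_def)
qed

section \<open>Block rows\<close>

text \<open>Position a of this list holds the block number of column a of a block row and its place
  inside the block. Sums and quantifiers over flat column numbers are converted to pairs through
  it.\<close>

definition block_index :: "nat \<Rightarrow> (nat \<Rightarrow> nat) \<Rightarrow> (nat \<times> nat) list" where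
  "block_index k c = concat (map (\<lambda>i. map (Pair i) [0..<c i]) [0..<k])"

lemma set_block_index: "set (block_index k c) = Sigma {..<k} (\<lambda>i. {..<c i})"
  by (auto simp: block_index_def)

lemma distinct_block_index: "distinct (block_index k c)"
  by (induction k) (auto simp: block_index_def distinct_map inj_on_def)

lemma length_block_index: "length (block_index k c) = (\<Sum>i<k. c i)"
  by (induction k) (auto simp: block_index_def)

lemma bij_betw_block_index:
  "bij_betw ((!) (block_index k c)) {..<\<Sum>i<k. c i} (Sigma {..<k} (\<lambda>i. {..<c i}))"
  using bij_betw_nth[OF distinct_block_index refl refl] by (simp add: length_block_index set_block_index)

lemma all_block_index:
  "(\<forall>a<\<Sum>i<k. c i. Q (block_index k c ! a)) \<longleftrightarrow> (\<forall>i<k. \<forall>j<c i. Q (i, j))"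
  using all_set_conv_all_nth[of "block_index k c" Q] by (auto simp: length_block_index set_block_index)

lemma block_index_eq_iff:
  "a < (\<Sum>i<k. c i) \<Longrightarrow> b < (\<Sum>i<k. c i) \<Longrightarrow> block_index k c ! a = block_index k c ! b \<longleftrightarrow> a = b"
  by (simp add: nth_eq_iff_index_eq distinct_block_index length_block_index)

lemma block_row_index:
  assumes "\<And>i. i < k \<Longrightarrow> M i \<in> carrier_mat n (c i)"
  shows "block_row n k M = mat_of_cols n (map (\<lambda>(i, j). col (M i) j) (block_index k c))"
proof -
  have "concat (map (\<lambda>i. cols (M i)) [0..<k]) = map (\<lambda>(i, j). col (M i) j) (block_index k c)"
    using assms[THEN carrier_matD(2)]
    by (auto simp: block_index_def map_concat cols_def comp_def intro!: arg_cong[of _ _ concat])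
  then show ?thesis by (simp add: block_row_def)
qed

lemma block_row_carrier:
  assumes "\<And>i. i < k \<Longrightarrow> M i \<in> carrier_mat n (c i)"
  shows "block_row n k M \<in> carrier_mat n (\<Sum>i<k. c i)"
  using block_row_index[of k M n c] assms by (auto simp: length_block_index intro: carrier_matI)

lemma col_block_row:
  assumes M: "\<And>i. i < k \<Longrightarrow> M i \<in> carrier_mat n (c i)" and a: "a < (\<Sum>i<k. c i)"
  shows "col (block_row n k M) a = (case block_index k c ! a of (i, j) \<Rightarrow> col (M i) j)"
proof -
  have "block_index k c ! a \<in> set (block_index k c)" using a by (simp add: length_block_index)
  then have "(case block_index k c ! a of (i, j) \<Rightarrow> col (M i) j) \<in> carrier_vec n"
    using M by (auto simp: set_block_index split: prod.splits)
  then show ?thesis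
    using a by (subst block_row_index[OF M]) (auto simp: length_block_index)
qed

text \<open>\<open>Q\<close> also receives the index pair, so a condition may depend on the block in
  which the column lies. Conditions on two columns are converted by two applications, one column
  being held fixed each time.\<close>

lemma all_col_block_row:
  assumes M: "\<And>i. i < k \<Longrightarrow> M i \<in> carrier_mat n (c i)"
  shows "(\<forall>a<\<Sum>i<k. c i. Q (block_index k c ! a) (col (block_row n k M) a)) \<longleftrightarrow> (\<forall>i<k. \<forall>j<c i. Q (i, j) (col (M i) j))"
  using all_block_index[where k = k and c = c and Q = "\<lambda>x. Q x (case x of (i, j) \<Rightarrow> col (M i) j)"] col_block_row[OF M] by simp

lemma block_row_partial_unitary_iff:
  assumes M: "\<And>i. i < k \<Longrightarrow> M i \<in> carrier_mat n (c i)"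
  shows "partial_unitary (block_row n k M) \<longleftrightarrow>
    (\<forall>i<k. \<forall>j<c i. \<forall>l<k. \<forall>m<c l. col (M l) m \<bullet>c col (M i) j = (if (i, j) = (l, m) then 1 else 0))"
proof -
  let ?N = "\<Sum>i<k. c i" and ?I = "block_index k c"
  have "partial_unitary (block_row n k M) \<longleftrightarrow> (\<forall>a<?N. \<forall>b<?N.
      col (block_row n k M) b \<bullet>c col (block_row n k M) a = (if ?I ! a = ?I ! b then 1 else 0))"
    using block_row_carrier[of k M n c, OF M] by (auto simp: partial_unitary_iff block_index_eq_iff)
  also have "\<dots> \<longleftrightarrow> (\<forall>a<?N. \<forall>l<k. \<forall>m<c l.
      col (M l) m \<bullet>c col (block_row n k M) a = (if ?I ! a = (l, m) then 1 else 0))"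
    using all_col_block_row[OF M, where Q = "\<lambda>y v. v \<bullet>c w = (if x = y then 1 else 0)" for w x] by simp
  also have "\<dots> \<longleftrightarrow> (\<forall>i<k. \<forall>j<c i. \<forall>l<k. \<forall>m<c l.
      col (M l) m \<bullet>c col (M i) j = (if (i, j) = (l, m) then 1 else 0))"
    by (rule all_col_block_row[OF M, where Q = "\<lambda>x v. \<forall>l<k. \<forall>m<c l. col (M l) m \<bullet>c v = (if x = (l, m) then 1 else 0)"])
  finally show ?thesis .
qed

lemma block_row_diagonal_iff:
  assumes A: "A \<in> carrier_mat n n" and M: "\<And>i. i < k \<Longrightarrow> M i \<in> carrier_mat n (c i)"
  shows "diagonal_mat (mat_adjoint (block_row n k M) * A * block_row n k M) \<longleftrightarrow>
    (\<forall>i<k. \<forall>j<c i. \<forall>l<k. \<forall>m<c l. (i, j) \<noteq> (l, m) \<longrightarrow> (mat_adjoint (M i) * A * M l) $$ (j, m) = 0)"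
proof -
  let ?N = "\<Sum>i<k. c i" and ?I = "block_index k c" and ?B = "block_row n k M"
  note B = block_row_carrier[of k M n c, OF M]
  have "diagonal_mat (mat_adjoint ?B * A * ?B) \<longleftrightarrow> (\<forall>a<?N. \<forall>b<?N.
      ?I ! a \<noteq> ?I ! b \<longrightarrow> (A *\<^sub>v col ?B b) \<bullet>c col ?B a = 0)"
    using B by (auto simp: diagonal_mat_def index_adjoint_sandwich[OF A B B] block_index_eq_iff simp del: index_mult_mat(1))
  also have "\<dots> \<longleftrightarrow> (\<forall>a<?N. \<forall>l<k. \<forall>m<c l.
      ?I ! a \<noteq> (l, m) \<longrightarrow> (A *\<^sub>v col (M l) m) \<bullet>c col ?B a = 0)"
    using all_col_block_row[OF M, where Q = "\<lambda>y v. x \<noteq> y \<longrightarrow> (A *\<^sub>v v) \<bullet>c w = 0" for w x] by simp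
  also have "\<dots> \<longleftrightarrow> (\<forall>i<k. \<forall>j<c i. \<forall>l<k. \<forall>m<c l.
      (i, j) \<noteq> (l, m) \<longrightarrow> (A *\<^sub>v col (M l) m) \<bullet>c col (M i) j = 0)"
    by (rule all_col_block_row[OF M, where Q = "\<lambda>x v. \<forall>l<k. \<forall>m<c l. x \<noteq> (l, m) \<longrightarrow> (A *\<^sub>v col (M l) m) \<bullet>c v = 0"])
  finally show ?thesis using index_adjoint_sandwich[OF A M M] by (auto simp del: index_mult_mat(1))
qed

text \<open>The outer product of a block row is the sum of the M_i M_i^*, and the summands with i
  other than l annihilate T.\<close>

lemma block_row_outer:
  assumes M: "\<And>i. i < k \<Longrightarrow> M i \<in> carrier_mat n (c i)" and T: "T \<in> carrier_mat n m" and l: "l < k"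
    and orth: "\<And>i. i < k \<Longrightarrow> i \<noteq> l \<Longrightarrow> mat_adjoint (M i) * T = 0\<^sub>m (c i) m"
  shows "block_row n k M * mat_adjoint (block_row n k M) * T = M l * (mat_adjoint (M l) * T)"
proof (rule eq_matI, goal_cases)
  case (1 a b)
  let ?N = "\<Sum>i<k. c i" and ?I = "block_index k c" and ?B = "block_row n k M"
  note B = block_row_carrier[of k M n c, OF M]
  have ab: "a < n" "b < m" using 1 M[OF l] T by auto
  have entry: "M i $$ (a, j) * (mat_adjoint (M i) * T) $$ (j, b) = col (M i) j $ a * (col T b \<bullet>c col (M i) j)"
    if "i < k" "j < c i" for i j
    using M[OF that(1)] that ab T by (simp add: index_adjoint_mult del: index_mult_mat(1))
  have "(?B * mat_adjoint ?B * T) $$ (a, b) = (?B * (mat_adjoint ?B * T)) $$ (a, b)"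
    using B T by (simp add: mult_mat_assoc)
  also have "\<dots> = (\<Sum>x<?N. col ?B x $ a * (col T b \<bullet>c col ?B x))"
    using B T ab by (subst index_mult_mat_sum) (auto simp: index_adjoint_mult simp del: index_mult_mat(1) intro!: sum.cong)
  also have "\<dots> = (\<Sum>x<?N. case ?I ! x of (i, j) \<Rightarrow> col (M i) j $ a * (col T b \<bullet>c col (M i) j))"
    using col_block_row[of k M n c, OF M] by (intro sum.cong) (auto split: prod.splits)
  also have "\<dots> = (\<Sum>(i, j)\<in>Sigma {..<k} (\<lambda>i. {..<c i}). col (M i) j $ a * (col T b \<bullet>c col (M i) j))"
    by (rule sum.reindex_bij_betw[OF bij_betw_block_index])
  also have "\<dots> = (\<Sum>i<k. \<Sum>j<c i. col (M i) j $ a * (col T b \<bullet>c col (M i) j))"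
    by (rule sum.Sigma[symmetric]) auto
  also have "\<dots> = (\<Sum>i<k. \<Sum>j<c i. M i $$ (a, j) * (mat_adjoint (M i) * T) $$ (j, b))"
    using entry by (intro sum.cong refl) auto
  also have "\<dots> = (\<Sum>i\<in>{l}. \<Sum>j<c i. M i $$ (a, j) * (mat_adjoint (M i) * T) $$ (j, b))"
    using l orth ab by (intro sum.mono_neutral_right) (auto simp del: index_mult_mat(1))
  also have "\<dots> = (M l * (mat_adjoint (M l) * T)) $$ (a, b)"
    using M[OF l] T ab by (simp add: index_mult_mat_sum[of a "M l" b "mat_adjoint (M l) * T"] del: index_mult_mat(1))
  finally show ?case .
qed (use M[OF l] T block_row_carrier[of k M n c, OF M] in auto)

section \<open>Stationary blocks\<close>

text \<open>On matrices orthogonal to the other U_i, the matrix S = X X^* acts as U_l Sigma_l^2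
  U_l^*, since V_l^* V_l = I. The two uses are T = U_l and T = A U_l.\<close>

lemma block_row_svd_outer:
  assumes svd: "\<And>i. i < k \<Longrightarrow> reduced_svd n (ps i) (rs i) (Xs i) (Us i) (\<sigma> i) (Vs i)"
    and T: "T \<in> carrier_mat n m" and l: "l < k"
    and orth: "\<And>i. i < k \<Longrightarrow> i \<noteq> l \<Longrightarrow> mat_adjoint (Us i) * T = 0\<^sub>m (rs i) m"
  shows "block_row n k Xs * mat_adjoint (block_row n k Xs) * T =
    Us l * (real_diag (rs l) (\<lambda>j. (\<sigma> l j)\<^sup>2) * (mat_adjoint (Us l) * T))"
proof -
  have d: "Xs i \<in> carrier_mat n (ps i)" "Us i \<in> carrier_mat n (rs i)" "Vs i \<in> carrier_mat (ps i) (rs i)"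
    "partial_unitary (Vs i)" "Xs i = Us i * real_diag (rs i) (\<sigma> i) * mat_adjoint (Vs i)" if "i < k" for i
    using svd[OF that] by (auto simp: reduced_svd_def)
  have XT: "mat_adjoint (Xs i) * T = Vs i * (real_diag (rs i) (\<sigma> i) * (mat_adjoint (Us i) * T))" if "i < k" for i
    using d(2,3)[OF that] T unfolding d(5)[OF that] by (simp add: mat_adjoint_mult mult_mat_assoc)
  have "mat_adjoint (Xs i) * T = 0\<^sub>m (ps i) m" if "i < k" "i \<noteq> l" for i
    using d(3)[OF that(1)] unfolding XT[OF that(1)] orth[OF that] by simp
  then have "block_row n k Xs * mat_adjoint (block_row n k Xs) * T = Xs l * (mat_adjoint (Xs l) * T)"
    by (intro block_row_outer[OF d(1) T l])
  also have "\<dots> = Us l * (real_diag (rs l) (\<sigma> l) * (real_diag (rs l) (\<sigma> l) * (mat_adjoint (Us l) * T)))"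
    using d(2,3)[OF l] T unfolding XT[OF l]
    by (subst d(5)[OF l]) (simp add: mult_mat_assoc partial_unitary_cancel[OF d(4)[OF l]])
  also have "\<dots> = Us l * (real_diag (rs l) (\<lambda>j. (\<sigma> l j)\<^sup>2) * (mat_adjoint (Us l) * T))"
    using d(2)[OF l] T by (simp add: power2_eq_square mult_mat_assoc flip: real_diag_mult_real_diag)
  finally show ?thesis .
qed

text \<open>S A u is a multiple of u even if A u leaves the column space of U, because S sees only
  U^* A u, and U^* A U is diagonal. What remains of A is the factor 2 - t, which vanishes exactly
  for the singular value sqrt 2.\<close>

lemma index_stat_op_mult:
  assumes A: "A \<in> carrier_mat n n" "hermitian_mat A" and S: "S \<in> carrier_mat n n"
    and U: "U \<in> carrier_mat n r" "diagonal_mat (mat_adjoint U * A * U)"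
    and SU: "S * U = U * real_diag r t"
    and SAU: "S * (A * U) = U * (real_diag r t * (mat_adjoint U * (A * U)))"
    and aj: "a < n" "j < r"
  shows "(stat_op A S * U) $$ (a, j) =
    (2 - of_real (t j)) * (A * U) $$ (a, j) - of_real (t j * diag_entry A U j) * U $$ (a, j)"
proof -
  have "mat_adjoint U * (A * U) = real_diag r (diag_entry A U)"
  proof (rule eq_matI, goal_cases)
    case (1 i j)
    then have "(mat_adjoint U * A * U) $$ (i, j) = real_diag r (diag_entry A U) $$ (i, j)"
      using U diag_entry_eq[OF A U(1), of i] unfolding diagonal_mat_def
      by (cases "i = j") (auto simp del: index_mult_mat(1))
    then show ?case using A(1) U(1) by (simp add: mult_mat_assoc)
  qed (use A U in auto)
  then have SAU': "S * (A * U) = U * real_diag r (\<lambda>j. t j * diag_entry A U j)"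
    using SAU by (simp add: real_diag_mult_real_diag)
  have "A * (U * real_diag r t) = A * U * real_diag r t" using A(1) U(1) by (simp add: mult_mat_assoc)
  then have "stat_op A S * U = 2 \<cdot>\<^sub>m (A * U) - A * U * real_diag r t - U * real_diag r (\<lambda>j. t j * diag_entry A U j)"
    using stat_op_mult[OF A(1) S, of U] U(1) unfolding SU SAU' by simp
  then show ?thesis
    using A(1) U(1) aj by (simp add: index_mult_real_diag algebra_simps del: index_mult_mat(1))
qed

text \<open>Comparing M u = -\<delta> u with \<open>index_stat_op_mult\<close> leaves (2 - t) A u =
  (t a - \<delta>) u, where a = u^* A u, and t different from 2 permits division. The contrapositive
  yields the singular value sqrt 2.\<close>

lemma stationary_block_eigenvector:
  assumes A: "A \<in> carrier_mat n n" "hermitian_mat A" and S: "S \<in> carrier_mat n n"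
    and U: "U \<in> carrier_mat n r" "diagonal_mat (mat_adjoint U * A * U)" "partial_unitary U"
    and SU: "S * U = U * real_diag r t"
    and SAU: "S * (A * U) = U * (real_diag r t * (mat_adjoint U * (A * U)))"
    and MU: "stat_op A S * U = complex_of_real (- \<delta>) \<cdot>\<^sub>m U"
    and j: "j < r" "t j \<noteq> 2"
  shows "\<exists>c. eigenvector A (col U j) c"
proof -
  define c where "c = complex_of_real ((t j * diag_entry A U j - \<delta>) / (2 - t j))"
  have "(A * U) $$ (a, j) = c * U $$ (a, j)" if "a < n" for a
  proof -
    have "complex_of_real (- \<delta>) * U $$ (a, j) =
        of_real (2 - t j) * (A * U) $$ (a, j) - of_real (t j * diag_entry A U j) * U $$ (a, j)"
      using index_stat_op_mult[OF A S U(1,2) SU SAU that j(1)] that j(1) U(1) unfolding MU by simp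
    then have "of_real (2 - t j) * (A * U) $$ (a, j) = of_real (t j * diag_entry A U j - \<delta>) * U $$ (a, j)"
      by (simp add: algebra_simps del: index_mult_mat(1))
    moreover have "complex_of_real (2 - t j) \<noteq> 0" using j(2) by (metis of_real_eq_0_iff right_minus_eq)
    ultimately show ?thesis unfolding c_def of_real_divide by (simp add: field_simps del: index_mult_mat(1))
  qed
  then have "col (A * U) j = c \<cdot>\<^sub>v col U j" using A(1) U(1) j(1) by (intro eq_vecI) auto
  then have "A *\<^sub>v col U j = c \<cdot>\<^sub>v col U j" using col_mult2[OF A(1) U(1) j(1)] by simp
  then show ?thesis
    using partial_unitary_col_nonzero[OF U(1,3) j(1)] A(1) U(1) j(1) unfolding eigenvector_def by auto
qed

text \<open>The point is that all columns share one eigenvalue, so that the equation passes to the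
  whole block. With a = u^* A u one has t a = a + D. If t = 2, then D = a and the term with A is
  gone; otherwise A u = a u, and (2 - 2 t) a = -2 D.\<close>

lemma stat_op_mult_eigenvectors:
  assumes A: "negative_definite_mat n A" and S: "S \<in> carrier_mat n n"
    and U: "U \<in> carrier_mat n r" "diagonal_mat (mat_adjoint U * A * U)" "partial_unitary U"
    and SU: "S * U = U * real_diag r t"
    and SAU: "S * (A * U) = U * (real_diag r t * (mat_adjoint U * (A * U)))"
    and t: "\<And>j. j < r \<Longrightarrow> t j = 1 + D / diag_entry A U j"
    and ev: "\<And>j. j < r \<Longrightarrow> (\<exists>c. eigenvector A (col U j) c) \<or> t j = 2"
  shows "stat_op A S * U = complex_of_real (- 2 * D) \<cdot>\<^sub>m U"
proof (rule eq_matI, goal_cases)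
  case (1 a j)
  have A': "A \<in> carrier_mat n n" "hermitian_mat A" using A by (auto simp: negative_definite_mat_def)
  have aj: "a < n" "j < r" using 1 U by auto
  let ?a = "diag_entry A U j"
  have aneg: "?a < 0" by (rule diag_entry_neg[OF A U(1,3) aj(2)])
  have ta: "t j * ?a = ?a + D" using t[OF aj(2)] aneg by (simp add: field_simps)
  have e: "(stat_op A S * U) $$ (a, j) = of_real (2 - t j) * (A * U) $$ (a, j) - of_real (t j * ?a) * U $$ (a, j)"
    using index_stat_op_mult[OF A' S U(1,2) SU SAU aj] by simp
  have "(stat_op A S * U) $$ (a, j) = of_real (- 2 * D) * U $$ (a, j)"
  proof (cases "t j = 2")
    case True
    then have "D = ?a" using ta by simp
    with True show ?thesis unfolding e by simp
  next
    case False
    with ev[OF aj(2)] obtain c where "eigenvector A (col U j) c" by blast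
    then have c: "A *\<^sub>v col U j = c \<cdot>\<^sub>v col U j" by (simp add: eigenvector_def)
    \<comment> \<open>The eigenvalue of a unit eigenvector is the value of the quadratic form, so
      \<open>c\<close> is the diagonal entry.\<close>
    have "of_real ?a = (A *\<^sub>v col U j) \<bullet>c col U j"
      using diag_entry_eq[OF A' U(1) aj(2)] index_adjoint_sandwich[OF A'(1) U(1,1) aj(2,2)] by simp
    also have "\<dots> = c * (col U j \<bullet>c col U j)"
      unfolding c using U(1) aj(2) by (intro smult_scalar_prod_distrib[of _ n]) auto
    also have "\<dots> = c" using U(1,3) aj(2) unfolding partial_unitary_iff by simp
    finally have "(A * U) $$ (a, j) = of_real ?a * U $$ (a, j)"
      using c aj A'(1) U(1) col_mult2[OF A'(1) U(1) aj(2)]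
      by (metis carrier_matD index_col index_mult_mat(2,3) index_smult_vec(1) dim_col)
    then have "(stat_op A S * U) $$ (a, j) = of_real ((2 - t j) * ?a - t j * ?a) * U $$ (a, j)"
      unfolding e by (simp add: algebra_simps)
    also have "(2 - t j) * ?a - t j * ?a = - 2 * D" using ta by (simp add: algebra_simps)
    finally show ?thesis .
  qed
  then show ?case using aj U(1) by simp
qed (use A S U in \<open>auto simp: negative_definite_mat_def stat_op_def\<close>)

section \<open>The first-order condition column by column, and permutations of the columns\<close>

lemma mult_eq_mult_real_diag_iff:
  assumes "N \<in> carrier_mat n n" "X \<in> carrier_mat n p"
  shows "N * X = X * real_diag p f \<longleftrightarrow> (\<forall>j<p. N *\<^sub>v col X j = of_real (f j) \<cdot>\<^sub>v col X j)"
proof -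
  have "col (X * real_diag p f) j = of_real (f j) \<cdot>\<^sub>v col X j" if "j < p" for j
    using assms that by (intro eq_vecI) (auto simp: index_mult_real_diag mult.commute simp del: index_mult_mat(1))
  moreover have "col (N * X) j = N *\<^sub>v col X j" if "j < p" for j
    using col_mult2[OF assms that] .
  ultimately have "(\<forall>j<p. N *\<^sub>v col X j = of_real (f j) \<cdot>\<^sub>v col X j) \<longleftrightarrow>
      (\<forall>j<p. col (N * X) j = col (X * real_diag p f) j)"
    by simp
  also have "\<dots> \<longleftrightarrow> N * X = X * real_diag p f"
    using assms mat_col_eqI[of "X * real_diag p f" "N * X"] by fastforce
  finally show ?thesis by simp
qed

lemma mult_real_diag_const: "dim_col X = p \<Longrightarrow> X * real_diag p (\<lambda>_. f) = complex_of_real f \<cdot>\<^sub>m X"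
  by (rule eq_matI) (auto simp: index_mult_real_diag simp del: index_mult_mat(1))

lemma oblique_manifold_iff:
  "X \<in> oblique_manifold n p \<longleftrightarrow> X \<in> carrier_mat n p \<and> (\<forall>j<p. col X j \<bullet>c col X j = 1)"
  by (auto simp: oblique_manifold_def index_adjoint_mult simp del: index_mult_mat(1))

text \<open>Multiplication by the diagonal matrix scales the columns separately, with
  \<open>f\<close> standing for -d. The matrix of the resulting eigenvector equations depends on X
  only through X X^*, which does not see the order of the columns.\<close>

lemma qomm_stationary_iff:
  assumes A: "A \<in> carrier_mat n n"
  shows "qomm_stationary n p A X \<longleftrightarrow> X \<in> oblique_manifold n p \<and>
    (\<exists>f. \<forall>j<p. stat_op A (X * mat_adjoint X) *\<^sub>v col X j = of_real (f j) \<cdot>\<^sub>v col X j)"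
proof (cases "X \<in> carrier_mat n p")
  case X: True
  let ?S = "X * mat_adjoint X"
  have S: "?S \<in> carrier_mat n n" using X by simp
  have N: "stat_op A ?S \<in> carrier_mat n n" using A S by simp
  have *: "2 \<cdot>\<^sub>m (A * X) - A * X * mat_adjoint X * X - X * mat_adjoint X * A * X + X * real_diag p d = 0\<^sub>m n p
      \<longleftrightarrow> stat_op A ?S * X = X * real_diag p (\<lambda>j. - d j)" for d
  proof -
    have "2 \<cdot>\<^sub>m (A * X) - A * X * mat_adjoint X * X - X * mat_adjoint X * A * X = stat_op A ?S * X"
      using A X by (simp add: stat_op_mult[OF A S] mult_mat_assoc)
    moreover have "stat_op A ?S * X + X * real_diag p d = 0\<^sub>m n p \<longleftrightarrow>
        (\<forall>i<n. \<forall>j<p. (stat_op A ?S * X) $$ (i, j) = - (X $$ (i, j) * of_real (d j)))"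
      using N X unfolding mat_eq_iff
      by (auto simp: index_mult_real_diag eq_neg_iff_add_eq_0 simp del: index_mult_mat(1))
    moreover have "stat_op A ?S * X = X * real_diag p (\<lambda>j. - d j) \<longleftrightarrow>
        (\<forall>i<n. \<forall>j<p. (stat_op A ?S * X) $$ (i, j) = - (X $$ (i, j) * of_real (d j)))"
      using N X unfolding mat_eq_iff
      by (auto simp: index_mult_real_diag simp del: index_mult_mat(1))
    ultimately show ?thesis by simp
  qed
  have "(\<exists>d. stat_op A ?S * X = X * real_diag p (\<lambda>j. - d j)) \<longleftrightarrow> (\<exists>f. stat_op A ?S * X = X * real_diag p f)"
  proof
    assume "\<exists>f. stat_op A ?S * X = X * real_diag p f"
    then obtain f where "stat_op A ?S * X = X * real_diag p (\<lambda>j. - (- f j))" by auto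
    then show "\<exists>d. stat_op A ?S * X = X * real_diag p (\<lambda>j. - d j)" by (rule exI[of _ "\<lambda>j. - f j"])
  qed blast
  then show ?thesis unfolding qomm_stationary_def * mult_eq_mult_real_diag_iff[OF N X] by simp
next
  case False
  then show ?thesis by (simp add: qomm_stationary_def oblique_manifold_def)
qed

lemma mult_adjoint_permute_cols:
  fixes X Y :: "complex mat"
  assumes X: "X \<in> carrier_mat n p" and Y: "Y \<in> carrier_mat n p" and \<pi>: "\<pi> permutes {..<p}"
    and col: "\<And>j. j < p \<Longrightarrow> col Y j = col X (\<pi> j)"
  shows "Y * mat_adjoint Y = X * mat_adjoint X"
proof (rule eq_matI, goal_cases)
  case (1 a b)
  then have ab: "a < n" "b < n" using X by auto
  have \<pi>p: "\<pi> j < p" if "j < p" for j using permutes_in_image[OF \<pi>, of j] that by simp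
  have Yi: "Y $$ (a, j) = X $$ (a, \<pi> j)" if "a < n" "j < p" for a j
    using arg_cong[OF col[OF that(2)], of "\<lambda>v. v $ a"] that X Y \<pi>p by simp
  have "(Y * mat_adjoint Y) $$ (a, b) = (\<Sum>j<p. X $$ (a, \<pi> j) * cnj (X $$ (b, \<pi> j)))"
    using ab Y Yi by (subst index_mult_mat_sum) auto
  also have "\<dots> = (\<Sum>j<p. X $$ (a, j) * cnj (X $$ (b, j)))"
    by (rule sum.reindex_bij_betw[OF permutes_imp_bij[OF \<pi>]])
  also have "\<dots> = (X * mat_adjoint X) $$ (a, b)"
    using ab X by (subst index_mult_mat_sum) auto
  finally show ?case .
qed (use X Y in auto)

lemma qomm_stationary_permute_cols:
  assumes A: "A \<in> carrier_mat n n" and X: "qomm_stationary n p A X" and Y: "Y \<in> carrier_mat n p"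
    and \<pi>: "\<pi> permutes {..<p}" and col: "\<And>j. j < p \<Longrightarrow> col Y j = col X (\<pi> j)"
  shows "qomm_stationary n p A Y"
proof -
  have \<pi>p: "\<pi> j < p" if "j < p" for j using permutes_in_image[OF \<pi>, of j] that by simp
  obtain f where f: "\<And>j. j < p \<Longrightarrow> stat_op A (X * mat_adjoint X) *\<^sub>v col X j = of_real (f j) \<cdot>\<^sub>v col X j"
    and ob: "X \<in> oblique_manifold n p"
    using X unfolding qomm_stationary_iff[OF A] by blast
  have X': "X \<in> carrier_mat n p" using ob by (simp add: oblique_manifold_def)
  have YX: "Y * mat_adjoint Y = X * mat_adjoint X"
    by (rule mult_adjoint_permute_cols[OF X' Y \<pi>]) (rule col)
  have "Y \<in> oblique_manifold n p" using ob Y col \<pi>p by (simp add: oblique_manifold_iff)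
  moreover have "stat_op A (Y * mat_adjoint Y) *\<^sub>v col Y j = of_real (f (\<pi> j)) \<cdot>\<^sub>v col Y j" if "j < p" for j
    using f[OF \<pi>p[OF that]] unfolding YX col[OF that] .
  ultimately show ?thesis unfolding qomm_stationary_iff[OF A] by (intro conjI exI[of _ "\<lambda>j. f (\<pi> j)"]) auto
qed

lemma col_mult_permutation:
  assumes X: "X \<in> carrier_mat n p" and \<pi>: "\<pi> permutes {..<p}" and j: "j < p"
  shows "col (X * map_mat complex_of_real (mat p p (\<lambda>(i, j). if i = \<pi> j then 1 else 0))) j = col X (\<pi> j)"
proof (rule eq_vecI, goal_cases)
  case (1 a)
  have \<pi>p: "\<pi> j < p" using permutes_in_image[OF \<pi>, of j] j by simp
  have "(X * map_mat complex_of_real (mat p p (\<lambda>(i, j). if i = \<pi> j then 1 else 0))) $$ (a, j) =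
      (\<Sum>i<p. X $$ (a, i) * of_real (if i = \<pi> j then 1 else 0))"
    using 1 X j by (subst index_mult_mat_sum) auto
  also have "\<dots> = X $$ (a, \<pi> j)" using \<pi>p by (simp add: if_distrib cong: if_cong)
  finally show ?case using 1 X j \<pi>p by simp
qed (use X j in auto)

section \<open>The block structure of stationary points\<close>

lemma mult_eq_smult_iff:
  assumes "N \<in> carrier_mat n n" "X \<in> carrier_mat n p"
  shows "N * X = complex_of_real f \<cdot>\<^sub>m X \<longleftrightarrow> (\<forall>j<p. N *\<^sub>v col X j = of_real f \<cdot>\<^sub>v col X j)"
  using mult_eq_mult_real_diag_iff[OF assms, of "\<lambda>_. f"] mult_real_diag_const[of X p f] assms(2) by simp

text \<open>Condition 1 makes U_i^* U_l and U_i^* A U_l vanish for i other than l, so on U_l and on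
  A U_l the matrix S acts through block l alone. The eigenvector equation obtained for U_l extends
  to X_l, which is a right multiple of U_l.\<close>

lemma qomm_conditions_stationary:
  assumes A: "negative_definite_mat n A"
    and sbs: "svd_block_structure n p k ps rs Xs Us \<sigma> Vs X"
    and cond: "qomm_conditions n A k ps rs Xs Us \<sigma> Vs"
  shows "qomm_stationary n p A X"
proof -
  have A': "A \<in> carrier_mat n n" "hermitian_mat A" using A by (auto simp: negative_definite_mat_def)
  have svd: "reduced_svd n (ps i) (rs i) (Xs i) (Us i) (\<sigma> i) (Vs i)" if "i < k" for i
    using sbs that by (auto simp: svd_block_structure_def)
  have p: "(\<Sum>i<k. ps i) = p" and X_eq: "X = block_row n k Xs"
    using sbs by (auto simp: svd_block_structure_def)
  have Xc: "Xs i \<in> carrier_mat n (ps i)" and Uc: "Us i \<in> carrier_mat n (rs i)"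
    and Vc: "Vs i \<in> carrier_mat (ps i) (rs i)" and Upu: "partial_unitary (Us i)"
    and Xi: "Xs i = Us i * real_diag (rs i) (\<sigma> i) * mat_adjoint (Vs i)" if "i < k" for i
    using svd[OF that] by (auto simp: reduced_svd_def)
  have ob: "Xs i \<in> oblique_manifold n (ps i)" if "i < k" for i
    using cond that by (auto simp: qomm_conditions_def)
  have pu: "col (Us l) m \<bullet>c col (Us i) j = 0" if "i < k" "j < rs i" "l < k" "m < rs l" "i \<noteq> l" for i j l m
    using cond block_row_partial_unitary_iff[of k Us n rs, OF Uc] that by (auto simp: qomm_conditions_def)
  have dg: "(mat_adjoint (Us i) * A * Us l) $$ (j, m) = 0"
    if "i < k" "j < rs i" "l < k" "m < rs l" "(i, j) \<noteq> (l, m)" for i j l m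
    using cond block_row_diagonal_iff[of A n k Us rs, OF A'(1) Uc] that
    by (auto simp: qomm_conditions_def simp del: index_mult_mat(1))
  let ?N = "stat_op A (X * mat_adjoint X)"
  have Xp: "X \<in> carrier_mat n p" using block_row_carrier[of k Xs n ps, OF Xc] by (simp add: X_eq p)
  then have S: "X * mat_adjoint X \<in> carrier_mat n n" by simp
  then have N: "?N \<in> carrier_mat n n" using A' by simp
  \<comment> \<open>The eigenvalue -2 D of \<open>stat_op_mult_eigenvectors\<close>, with D read off
    from \<open>sigma_formula\<close>; it is minus the multiplier common to all columns of block
    l.\<close>
  define g where "g l = - 2 * ((real (ps l) - real (rs l)) / (\<Sum>j<rs l. 1 / diag_entry A (Us l) j))" for l
  have NX: "?N * Xs l = complex_of_real (g l) \<cdot>\<^sub>m Xs l" if l: "l < k" for l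
  proof -
    have UU: "mat_adjoint (Us i) * Us l = 0\<^sub>m (rs i) (rs l)" if "i < k" "i \<noteq> l" for i
      using pu[OF that(1) _ l] that Uc[OF that(1)] Uc[OF l]
      by (intro eq_matI) (auto simp: index_adjoint_mult simp del: index_mult_mat(1))
    have UAU: "mat_adjoint (Us i) * (A * Us l) = 0\<^sub>m (rs i) (rs l)" if "i < k" "i \<noteq> l" for i
    proof -
      have "mat_adjoint (Us i) * A * Us l = 0\<^sub>m (rs i) (rs l)"
        using dg[OF that(1) _ l] that Uc[OF that(1)] Uc[OF l]
        by (intro eq_matI) (auto simp del: index_mult_mat(1))
      then show ?thesis using Uc[OF that(1)] Uc[OF l] A'(1) by (simp add: mult_mat_assoc)
    qed
    let ?t = "\<lambda>j. (\<sigma> l j)\<^sup>2"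
    have SU: "X * mat_adjoint X * Us l = Us l * real_diag (rs l) ?t"
    proof -
      have "X * mat_adjoint X * Us l = Us l * (real_diag (rs l) ?t * (mat_adjoint (Us l) * Us l))"
        unfolding X_eq by (rule block_row_svd_outer[OF svd Uc[OF l] l UU])
      then show ?thesis
        using Uc[OF l] right_mult_one_mat[OF real_diag_carrier, of "rs l" ?t]
        unfolding partial_unitaryD[OF Upu[OF l]] by simp
    qed
    have SAU: "X * mat_adjoint X * (A * Us l) = Us l * (real_diag (rs l) ?t * (mat_adjoint (Us l) * (A * Us l)))"
      unfolding X_eq by (rule block_row_svd_outer[OF svd mult_carrier_mat[OF A'(1) Uc[OF l]] l UAU])
    have diag: "diagonal_mat (mat_adjoint (Us l) * A * Us l)"
      using dg[OF l _ l] Uc[OF l] by (auto simp: diagonal_mat_def simp del: index_mult_mat(1))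
    let ?D = "(real (ps l) - real (rs l)) / (\<Sum>j<rs l. 1 / diag_entry A (Us l) j)"
    have "?N * Us l = complex_of_real (- 2 * ?D) \<cdot>\<^sub>m Us l"
    proof (rule stat_op_mult_eigenvectors[OF A S Uc[OF l] diag Upu[OF l] SU SAU])
      fix j assume j: "j < rs l"
      have s: "\<sigma> l j = sigma_formula A (ps l) (rs l) (Us l) j" "1 \<le> \<sigma> l j"
        "(\<nexists>c. eigenvector A (col (Us l) j) c) \<longrightarrow> \<sigma> l j = sqrt 2"
        using cond l j unfolding qomm_conditions_def by blast+
      show "(\<exists>c. eigenvector A (col (Us l) j) c) \<or> (\<sigma> l j)\<^sup>2 = 2" using s(3) by auto
      \<comment> \<open>\<open>sqrt\<close> is an odd function on the reals, so a positive value
        forces a positive radicand, and squaring really removes the root.\<close>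
      have "0 < sigma_formula A (ps l) (rs l) (Us l) j" using s(1,2) by linarith
      then show "(\<sigma> l j)\<^sup>2 = 1 + ?D / diag_entry A (Us l) j"
        unfolding s(1) unfolding sigma_formula_def real_sqrt_gt_0_iff by (simp add: mult.commute)
    qed
    moreover have "?N * Xs l = ?N * Us l * (real_diag (rs l) (\<sigma> l) * mat_adjoint (Vs l))"
      using N Uc[OF l] Vc[OF l] by (subst Xi[OF l]) (simp add: mult_mat_assoc)
    ultimately have "?N * Xs l = complex_of_real (- 2 * ?D) \<cdot>\<^sub>m (Us l * (real_diag (rs l) (\<sigma> l) * mat_adjoint (Vs l)))"
      using Uc[OF l] Vc[OF l] by (simp only:) (simp add: smult_mult_mat)
    also have "Us l * (real_diag (rs l) (\<sigma> l) * mat_adjoint (Vs l)) = Xs l"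
      using Uc[OF l] Vc[OF l] unfolding Xi[OF l] by (simp add: mult_mat_assoc)
    finally show ?thesis by (simp only: g_def)
  qed
  let ?I = "block_index k ps"
  have "\<forall>a<\<Sum>i<k. ps i. ?N *\<^sub>v col (block_row n k Xs) a = of_real (g (fst (?I ! a))) \<cdot>\<^sub>v col (block_row n k Xs) a"
    by (rule all_col_block_row[where k = k and M = Xs and n = n and c = ps and Q = "\<lambda>x v. ?N *\<^sub>v v = of_real (g (fst x)) \<cdot>\<^sub>v v",
        OF Xc, THEN iffD2])
      (use NX mult_eq_smult_iff[OF N Xc] in auto)
  moreover have "\<forall>a<\<Sum>i<k. ps i. col (block_row n k Xs) a \<bullet>c col (block_row n k Xs) a = 1"
    by (rule all_col_block_row[where k = k and M = Xs and n = n and c = ps and Q = "\<lambda>x v. v \<bullet>c v = 1",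
        OF Xc, THEN iffD2])
      (use ob in \<open>auto simp: oblique_manifold_iff\<close>)
  ultimately show ?thesis
    unfolding qomm_stationary_iff[OF A'(1)] oblique_manifold_iff using Xp p
    by (intro conjI exI[of _ "\<lambda>a. g (fst (?I ! a))"]) (simp_all add: X_eq)
qed

section \<open>From a stationary point to its blocks of equal multiplier\<close>

lemma hermitian_eigenvectors_orthogonal:
  assumes N: "N \<in> carrier_mat n n" "hermitian_mat N" and P: "P \<in> carrier_mat n q" and R: "R \<in> carrier_mat n r"
    and NP: "N * P = complex_of_real a \<cdot>\<^sub>m P" and NR: "N * R = complex_of_real b \<cdot>\<^sub>m R" and ab: "a \<noteq> b"
  shows "mat_adjoint P * R = 0\<^sub>m q r"
proof (rule eq_matI, goal_cases)
  case (1 i j)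
  then have ij: "i < q" "j < r" by auto
  have "mat_adjoint P * N = mat_adjoint (N * P)"
    using N P unfolding hermitian_mat_def by (simp add: mat_adjoint_mult)
  also have "\<dots> = complex_of_real a \<cdot>\<^sub>m mat_adjoint P"
    unfolding NP using P by (intro eq_matI) auto
  finally have "complex_of_real a \<cdot>\<^sub>m (mat_adjoint P * R) = mat_adjoint P * N * R"
    using P R by (simp add: smult_mult_mat)
  also have "\<dots> = mat_adjoint P * (N * R)" using N P R by (simp add: mult_mat_assoc)
  also have "\<dots> = complex_of_real b \<cdot>\<^sub>m (mat_adjoint P * R)"
    unfolding NR using P R by (simp add: smult_mult_mat)
  finally have "(complex_of_real a \<cdot>\<^sub>m (mat_adjoint P * R)) $$ (i, j) = (complex_of_real b \<cdot>\<^sub>m (mat_adjoint P * R)) $$ (i, j)"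
    by simp
  then have "complex_of_real a * (mat_adjoint P * R) $$ (i, j) = complex_of_real b * (mat_adjoint P * R) $$ (i, j)"
    using P R ij by (simp del: index_mult_mat(1))
  then show ?case using ab ij by (simp del: index_mult_mat(1))
qed (use P R in auto)

text \<open>The columns are sorted by the value of \<open>f\<close>: \<open>L i\<close> collects the
  indices with the i-th value, and reading these lists one after another gives \<open>\<pi>\<close>.
  Distinct values for distinct blocks are what later yields the orthogonality of the blocks and the
  uniqueness of the one of full rank.\<close>

lemma group_columns:
  fixes f :: "nat \<Rightarrow> real"
  obtains k c vals \<pi> where "distinct vals" "length vals = k" "\<pi> permutes {..<p}" "(\<Sum>i<k. c i) = p"
    "\<And>i. i < k \<Longrightarrow> 1 \<le> c i"
    "\<And>a. a < p \<Longrightarrow> f (\<pi> a) = vals ! fst (block_index k c ! a)"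
proof -
  define vals where "vals = sorted_list_of_set (f ` {..<p})"
  define k where "k = length vals"
  define L where "L i = filter (\<lambda>j. f j = vals ! i) [0..<p]" for i
  define c where "c i = length (L i)" for i
  define e where "e = (\<lambda>(i, j). L i ! j)"
  have vals: "distinct vals" "set vals = f ` {..<p}" by (auto simp: vals_def)
  have setL: "set (L i) = {j. j < p \<and> f j = vals ! i}" and dL: "distinct (L i)" for i
    by (auto simp: L_def)
  have Lnth: "L i ! j < p" "f (L i ! j) = vals ! i" if "j < c i" for i j
    using setL[of i] nth_mem[of j "L i"] that by (auto simp: c_def)
  have bij: "bij_betw e (Sigma {..<k} (\<lambda>i. {..<c i})) {..<p}"
    unfolding bij_betw_def
  proof
    show "inj_on e (Sigma {..<k} (\<lambda>i. {..<c i}))"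
    proof (rule inj_onI, clarify)
      fix i j i' j' assume *: "i < k" "j < c i" "i' < k" "j' < c i'" and eq: "e (i, j) = e (i', j')"
      have "vals ! i = vals ! i'" using Lnth(2)[OF *(2)] Lnth(2)[OF *(4)] eq by (simp add: e_def)
      then have ii: "i = i'" using vals(1) *(1,3) by (simp add: nth_eq_iff_index_eq k_def)
      then have "j = j'" using eq * dL by (simp add: e_def nth_eq_iff_index_eq c_def)
      with ii show "i = i' \<and> j = j'" by simp
    qed
    show "e ` (Sigma {..<k} (\<lambda>i. {..<c i})) = {..<p}"
    proof
      show "e ` (Sigma {..<k} (\<lambda>i. {..<c i})) \<subseteq> {..<p}" using Lnth(1) by (auto simp: e_def)
      show "{..<p} \<subseteq> e ` (Sigma {..<k} (\<lambda>i. {..<c i}))"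
      proof
        fix a assume a: "a \<in> {..<p}"
        then obtain i where i: "i < k" "vals ! i = f a" using vals(2) in_set_conv_nth[of "f a" vals] by (auto simp: k_def)
        then have "a \<in> set (L i)" using a setL by auto
        then obtain j where "j < c i" "L i ! j = a" by (auto simp: in_set_conv_nth c_def)
        then show "a \<in> e ` (Sigma {..<k} (\<lambda>i. {..<c i}))" using i by (intro image_eqI[of _ _ "(i, j)"]) (auto simp: e_def)
      qed
    qed
  qed
  have sum: "(\<Sum>i<k. c i) = p" using bij_betw_same_card[OF bij] by simp
  \<comment> \<open>The identity beyond p is what \<open>permutes\<close> demands of a permutation
    of \<open>{..<p}\<close>.\<close>
  define \<pi> where "\<pi> a = (if a < p then e (block_index k c ! a) else a)" for a
  have "bij_betw (\<lambda>a. e (block_index k c ! a)) {..<p} {..<p}"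
    using bij_betw_trans[OF bij_betw_block_index bij, unfolded sum] by (simp add: comp_def)
  then have "bij_betw \<pi> {..<p} {..<p}" by (rule bij_betw_cong[THEN iffD1, rotated]) (simp add: \<pi>_def)
  then have perm: "\<pi> permutes {..<p}" by (rule bij_imp_permutes) (simp add: \<pi>_def)
  have "1 \<le> c i" if "i < k" for i
  proof -
    have "vals ! i \<in> f ` {..<p}" using that vals(2) nth_mem[of i vals] by (simp add: k_def)
    then obtain a where "a < p" "f a = vals ! i" by force
    then have "a \<in> set (L i)" using setL[of i] by simp
    then show ?thesis by (cases "L i") (auto simp: c_def)
  qed
  moreover have "f (\<pi> a) = vals ! fst (block_index k c ! a)" if a: "a < p" for a
  proof -
    have "block_index k c ! a \<in> Sigma {..<k} (\<lambda>i. {..<c i})"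
      using bij_betw_apply[OF bij_betw_block_index] a sum by simp
    then show ?thesis using a Lnth(2) by (auto simp: \<pi>_def e_def)
  qed
  ultimately show thesis using that[OF vals(1) k_def[symmetric] perm sum] by blast
qed

lemma exists_block_row:
  assumes "Y \<in> carrier_mat n p" "(\<Sum>i<k. c i) = p"
  obtains Xs where "\<And>i. i < k \<Longrightarrow> Xs i \<in> carrier_mat n (c i)" "Y = block_row n k Xs"
proof -
  let ?I = "block_index k c"
  \<comment> \<open>The inverse of \<open>block_index\<close>: the flat column number that belongs
    to a pair.\<close>
  define h where "h x = (THE a. a < p \<and> ?I ! a = x)" for x
  have h: "h (?I ! a) = a" if "a < p" for a
    unfolding h_def using that assms(2) by (intro the_equality) (auto simp: block_index_eq_iff)
  define Xs where "Xs i = mat n (c i) (\<lambda>(a, j). Y $$ (a, h (i, j)))" for i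
  have Xs: "Xs i \<in> carrier_mat n (c i)" for i by (simp add: Xs_def)
  have "col Y a = col (block_row n k Xs) a" if a: "a < p" for a
  proof -
    obtain i j where ij: "?I ! a = (i, j)" by (cases "?I ! a")
    have "(i, j) \<in> Sigma {..<k} (\<lambda>i. {..<c i})"
      using bij_betw_apply[OF bij_betw_block_index, of a c k] a ij assms(2) by simp
    then have "j < c i" by simp
    then have "col (Xs i) j = col Y a"
      using h[OF a] ij assms(1) a by (intro eq_vecI) (auto simp: Xs_def)
    then show ?thesis using col_block_row[of k Xs n c, OF Xs] a assms(2) ij by simp
  qed
  then have "Y = block_row n k Xs"
    using assms block_row_carrier[of k Xs n c, OF Xs] by (intro mat_col_eqI) auto
  then show thesis using that Xs by blast
qed

text \<open>Beyond the single-block facts, the blocks have to be decoupled: first the X_i are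
  orthogonal, then the U_i, then U_i^* A U_l vanishes. The last of these gives S A U_i, which the
  claim about sqrt 2 needs.\<close>

lemma stationary_blocks:
  assumes A: "negative_definite_mat n A"
    and Xs: "\<And>i. i < k \<Longrightarrow> Xs i \<in> carrier_mat n (c i)" and c: "\<And>i. i < k \<Longrightarrow> 1 \<le> c i"
    and X: "X = block_row n k Xs" "X \<in> oblique_manifold n p" and p: "(\<Sum>i<k. c i) = p"
    and vals: "distinct vals" "length vals = k"
    and NX: "\<And>i. i < k \<Longrightarrow> stat_op A (X * mat_adjoint X) * Xs i = complex_of_real (vals ! i) \<cdot>\<^sub>m Xs i"
  shows "\<exists>rs Us \<sigma> Vs. svd_block_structure n p k c rs Xs Us \<sigma> Vs X \<and> qomm_conditions n A k c rs Xs Us \<sigma> Vs"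
proof -
  have A': "A \<in> carrier_mat n n" "hermitian_mat A" using A by (auto simp: negative_definite_mat_def)
  let ?S = "X * mat_adjoint X"
  let ?N = "stat_op A ?S"
  define \<delta> where "\<delta> i = - vals ! i" for i
  have \<delta>: "\<delta> i = \<delta> l \<longleftrightarrow> i = l" if "i < k" "l < k" for i l
    using vals that by (simp add: \<delta>_def nth_eq_iff_index_eq)
  have NX': "?N * Xs i = complex_of_real (- \<delta> i) \<cdot>\<^sub>m Xs i" if "i < k" for i
    using NX[OF that] by (simp add: \<delta>_def)
  have Xc: "X \<in> carrier_mat n p" using X(2) by (simp add: oblique_manifold_def)
  have S: "?S \<in> carrier_mat n n" "hermitian_mat ?S"
    using Xc by (auto simp: hermitian_mat_def mat_adjoint_mult)
  have N: "?N \<in> carrier_mat n n" "hermitian_mat ?N"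
    using hermitian_stat_op[OF A'(1) S(1) A'(2) S(2)] A' S by auto
  have ob: "Xs i \<in> oblique_manifold n (c i)" if "i < k" for i
  proof -
    have "\<forall>a<\<Sum>i<k. c i. col (block_row n k Xs) a \<bullet>c col (block_row n k Xs) a = 1"
      using X(2) p unfolding oblique_manifold_iff X(1) by simp
    then have "\<forall>i<k. \<forall>j<c i. col (Xs i) j \<bullet>c col (Xs i) j = 1"
      by (rule all_col_block_row[where k = k and M = Xs and n = n and c = c and Q = "\<lambda>x v. v \<bullet>c v = 1",
            OF Xs, THEN iffD1, rotated])
    then show ?thesis using Xs that by (simp add: oblique_manifold_iff)
  qed
  have XX: "mat_adjoint (Xs i) * Xs l = 0\<^sub>m (c i) (c l)" if "i < k" "l < k" "i \<noteq> l" for i l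
    using hermitian_eigenvectors_orthogonal[OF N Xs[OF that(1)] Xs[OF that(2)] NX'[OF that(1)] NX'[OF that(2)]]
      \<delta>[OF that(1,2)] that(3) by simp
  \<comment> \<open>Orthogonality removes the other blocks from S X_l; this makes the single-block
    facts applicable although S is built from all blocks.\<close>
  have SX: "?S * Xs l = Xs l * (mat_adjoint (Xs l) * Xs l)" if "l < k" for l
    unfolding X(1) by (rule block_row_outer[OF Xs Xs[OF that] that XX[OF _ that]])
  \<comment> \<open>One choice for all blocks; the guard \<open>i < k\<close> leaves the values
    beyond the last block arbitrary.\<close>
  have "\<forall>i. \<exists>B. i < k \<longrightarrow> (case B of (r, U, s, V) \<Rightarrow> reduced_svd n (c i) r (Xs i) U s V \<and>
      diagonal_mat (mat_adjoint U * A * U) \<and> (\<delta> i = 0 \<longrightarrow> Xs i = U * mat_adjoint V))"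
  proof (intro allI)
    fix i
    show "\<exists>B. i < k \<longrightarrow> (case B of (r, U, s, V) \<Rightarrow> reduced_svd n (c i) r (Xs i) U s V \<and>
      diagonal_mat (mat_adjoint U * A * U) \<and> (\<delta> i = 0 \<longrightarrow> Xs i = U * mat_adjoint V))"
    proof (cases "i < k")
      case True
      obtain r U s V where "reduced_svd n (c i) r (Xs i) U s V" "diagonal_mat (mat_adjoint U * A * U)"
        "\<delta> i = 0 \<Longrightarrow> Xs i = U * mat_adjoint V"
        using svd_block[OF A S ob[OF True] c[OF True] SX[OF True] NX'[OF True]] by blast
      then show ?thesis by (intro exI[of _ "(r, U, s, V)"]) simp
    qed simp
  qed
  then obtain B where B: "\<forall>i. i < k \<longrightarrow> (case B i of (r, U, s, V) \<Rightarrow> reduced_svd n (c i) r (Xs i) U s V \<and>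
      diagonal_mat (mat_adjoint U * A * U) \<and> (\<delta> i = 0 \<longrightarrow> Xs i = U * mat_adjoint V))"
    by (rule choice[THEN exE])
  define rs Us \<sigma> Vs where "rs = (\<lambda>i. fst (B i))" and "Us = (\<lambda>i. fst (snd (B i)))"
    and "\<sigma> = (\<lambda>i. fst (snd (snd (B i))))" and "Vs = (\<lambda>i. snd (snd (snd (B i))))"
  have svd: "reduced_svd n (c i) (rs i) (Xs i) (Us i) (\<sigma> i) (Vs i)"
    and diag: "diagonal_mat (mat_adjoint (Us i) * A * Us i)"
    and XUV: "\<delta> i = 0 \<Longrightarrow> Xs i = Us i * mat_adjoint (Vs i)" if "i < k" for i
    using B that by (auto simp: rs_def Us_def \<sigma>_def Vs_def case_prod_beta)
  note basic = svd_block_basic[OF A S ob c SX NX' svd]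
  have Uc: "Us i \<in> carrier_mat n (rs i)" and Vc: "Vs i \<in> carrier_mat (c i) (rs i)"
    and Upu: "partial_unitary (Us i)" and Vpu: "partial_unitary (Vs i)" if "i < k" for i
    using svd[OF that] by (auto simp: reduced_svd_def)
  \<comment> \<open>The left singular vectors inherit the eigenvalue of their block under
    \<open>?N\<close>, so the eigenvector argument applies to them as well.\<close>
  have UU: "mat_adjoint (Us i) * Us l = 0\<^sub>m (rs i) (rs l)" if "i < k" "l < k" "i \<noteq> l" for i l
    using hermitian_eigenvectors_orthogonal[OF N Uc[OF that(1)] Uc[OF that(2)]
        basic(2)[OF that(1,1,1,1,1)] basic(2)[OF that(2,2,2,2,2)]] \<delta>[OF that(1,2)] that(3) by simp
  have UAU: "mat_adjoint (Us i) * A * Us l = 0\<^sub>m (rs i) (rs l)" if il: "i < k" "l < k" "i \<noteq> l" for i l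
  proof (rule eq_matI, goal_cases)
    case (1 j m)
    then have jm: "j < rs i" "m < rs l" by auto
    \<comment> \<open>\<open>?N\<close> only scales U_l, which is orthogonal to U_i; the sandwich
      formula then leaves a scalar factor times the entry of U_i^* A U_l.\<close>
    have "mat_adjoint (Us i) * (?N * Us l) = complex_of_real (- \<delta> l) \<cdot>\<^sub>m (mat_adjoint (Us i) * Us l)"
      unfolding basic(2)[OF il(2,2,2,2,2)] using Uc[OF il(1)] Uc[OF il(2)] by (simp add: smult_mult_mat)
    then have "(mat_adjoint (Us i) * (?N * Us l)) $$ (j, m) = 0"
      unfolding UU[OF il] using jm by simp
    then have "complex_of_real (2 - (\<sigma> l m)\<^sup>2 - (\<sigma> i j)\<^sup>2) * (mat_adjoint (Us i) * A * Us l) $$ (j, m) = 0"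
      using stat_op_sandwich[OF A'(1) S Uc[OF il(2)] basic(1)[OF il(2,2,2,2,2)]
          Uc[OF il(1)] basic(1)[OF il(1,1,1,1,1)] jm] by (simp del: index_mult_mat(1))
    \<comment> \<open>The multipliers differ, so at most one of them is zero: one square exceeds 1,
      and the other is at least 1.\<close>
    moreover have "2 - (\<sigma> l m)\<^sup>2 - (\<sigma> i j)\<^sup>2 < 0"
    proof -
      have ge: "1 \<le> (\<sigma> l m)\<^sup>2" "1 \<le> (\<sigma> i j)\<^sup>2"
        using basic(5)[OF il(2,2,2,2,2) jm(2)] basic(5)[OF il(1,1,1,1,1) jm(1)] by (auto intro: one_le_power)
      have "\<delta> l \<noteq> 0 \<or> \<delta> i \<noteq> 0" using \<delta>[OF il(1,2)] il(3) by auto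
      then have "1 < (\<sigma> l m)\<^sup>2 \<or> 1 < (\<sigma> i j)\<^sup>2"
        using basic(8)[OF il(2,2,2,2,2) _ jm(2)] basic(8)[OF il(1,1,1,1,1) _ jm(1)] by (auto intro: one_less_power)
      with ge show ?thesis by linarith
    qed
    ultimately have "(mat_adjoint (Us i) * A * Us l) $$ (j, m) = 0"
      unfolding mult_eq_0_iff of_real_eq_0_iff by linarith
    then show ?case using jm by simp
  qed (use Uc[OF il(1)] Uc[OF il(2)] in auto)
  have "partial_unitary (block_row n k Us)"
  proof (rule block_row_partial_unitary_iff[of k Us n rs, THEN iffD2], fact Uc, intro allI impI)
    fix i j l m assume *: "i < k" "j < rs i" "l < k" "m < rs l"
    show "col (Us l) m \<bullet>c col (Us i) j = (if (i, j) = (l, m) then 1 else 0)"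
    proof (cases "i = l")
      case True
      then show ?thesis using Upu[OF *(1)] Uc[OF *(1)] * unfolding partial_unitary_iff by auto
    next
      case False
      then show ?thesis
        using arg_cong[OF UU[OF *(1,3) False], of "\<lambda>M. M $$ (j, m)"] Uc[OF *(1)] Uc[OF *(3)] *
        by (simp add: index_adjoint_mult del: index_mult_mat(1))
    qed
  qed
  moreover have "diagonal_mat (mat_adjoint (block_row n k Us) * A * block_row n k Us)"
  proof (rule block_row_diagonal_iff[of A n k Us rs, THEN iffD2], fact A', fact Uc, intro allI impI)
    fix i j l m assume *: "i < k" "j < rs i" "l < k" "m < rs l" "(i, j) \<noteq> (l, m)"
    show "(mat_adjoint (Us i) * A * Us l) $$ (j, m) = 0"
    proof (cases "i = l")
      case True
      then show ?thesis using diag[OF *(1)] Uc[OF *(1)] * unfolding diagonal_mat_def by (simp del: index_mult_mat(1))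
    next
      case False
      then show ?thesis unfolding UAU[OF *(1,3) False] using * by simp
    qed
  qed
  moreover have "\<sigma> i j = sqrt 2" if ij: "i < k" "j < rs i" and ne: "\<nexists>c. eigenvector A (col (Us i) j) c" for i j
  proof -
    have "mat_adjoint (Us l) * (A * Us i) = 0\<^sub>m (rs l) (rs i)" if "l < k" "l \<noteq> i" for l
      using UAU[OF that(1) ij(1) that(2)] Uc[OF that(1)] Uc[OF ij(1)] A'(1) by (simp add: mult_mat_assoc)
    then have "?S * (A * Us i) = Us i * (real_diag (rs i) (\<lambda>j. (\<sigma> i j)\<^sup>2) * (mat_adjoint (Us i) * (A * Us i)))"
      unfolding X(1) by (intro block_row_svd_outer[OF svd mult_carrier_mat[OF A'(1) Uc[OF ij(1)]] ij(1)])
    then have "(\<sigma> i j)\<^sup>2 = 2"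
      using stationary_block_eigenvector[OF A' S(1) Uc[OF ij(1)] diag[OF ij(1)] Upu[OF ij(1)]
          basic(1)[OF ij(1,1,1,1,1)] _ basic(2)[OF ij(1,1,1,1,1)] ij(2)] ne by blast
    moreover have "1 \<le> \<sigma> i j" by (rule basic(5)[OF ij(1,1,1,1,1) ij(2)])
    ultimately show ?thesis using real_sqrt_unique[of "\<sigma> i j" 2] by simp
  qed
  moreover have "\<sigma> i j = sigma_formula A (c i) (rs i) (Us i) j" "1 \<le> \<sigma> i j" if "i < k" "j < rs i" for i j
    using basic(4,5)[OF that(1,1,1,1,1) that(2)] by auto
  \<comment> \<open>Full rank means multiplier zero, and distinct multipliers allow this only
    once.\<close>
  moreover have r: "rs i = c i \<longleftrightarrow> \<delta> i = 0" if "i < k" for i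
    using basic(6)[OF that that that that that] by simp
  moreover have "i = i'" if "i < k" "i' < k" "rs i = c i" "rs i' = c i'" for i i'
    using r[OF that(1)] r[OF that(2)] \<delta>[OF that(1,2)] that(3,4) by simp
  ultimately have "qomm_conditions n A k c rs Xs Us \<sigma> Vs"
    unfolding qomm_conditions_def using XUV Vpu ob by (intro conjI allI impI) blast+
  moreover have "svd_block_structure n p k c rs Xs Us \<sigma> Vs X"
    unfolding svd_block_structure_def using c p Xs svd reduced_svd_rank[OF svd] X(1) by blast
  ultimately show ?thesis by blast
qed

lemma stationary_imp_conditions:
  assumes A: "negative_definite_mat n A" and Y: "qomm_stationary n p A Y"
  shows "\<exists>X P k ps rs Xs Us \<sigma> Vs. permutation_matrix p P \<and> Y = X * map_mat complex_of_real P \<and>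
    svd_block_structure n p k ps rs Xs Us \<sigma> Vs X \<and> qomm_conditions n A k ps rs Xs Us \<sigma> Vs"
proof -
  have A': "A \<in> carrier_mat n n" using A by (simp add: negative_definite_mat_def)
  obtain f where f: "\<And>j. j < p \<Longrightarrow> stat_op A (Y * mat_adjoint Y) *\<^sub>v col Y j = of_real (f j) \<cdot>\<^sub>v col Y j"
    and obY: "Y \<in> oblique_manifold n p"
    using Y unfolding qomm_stationary_iff[OF A'] by blast
  have Yc: "Y \<in> carrier_mat n p" using obY by (simp add: oblique_manifold_def)
  obtain k c vals \<pi> where vals: "distinct vals" "length vals = k" and \<pi>: "\<pi> permutes {..<p}"
    and p: "(\<Sum>i<k. c i) = p" and c: "\<And>i. i < k \<Longrightarrow> 1 \<le> c i"
    and f\<pi>: "\<And>a. a < p \<Longrightarrow> f (\<pi> a) = vals ! fst (block_index k c ! a)"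
    using group_columns[of p f] by metis
  define X where "X = mat n p (\<lambda>(a, j). Y $$ (a, \<pi> j))"
  have Xc: "X \<in> carrier_mat n p" by (simp add: X_def)
  have \<pi>p: "\<pi> j < p" if "j < p" for j using permutes_in_image[OF \<pi>, of j] that by simp
  have colX: "col X j = col Y (\<pi> j)" if "j < p" for j
    using that \<pi>p[OF that] Yc by (intro eq_vecI) (auto simp: X_def)
  have XY: "X * mat_adjoint X = Y * mat_adjoint Y"
    by (rule mult_adjoint_permute_cols[OF Yc Xc \<pi>]) (rule colX)
  have obX: "X \<in> oblique_manifold n p" using obY Xc colX \<pi>p by (simp add: oblique_manifold_iff)
  obtain Xs where Xs: "\<And>i. i < k \<Longrightarrow> Xs i \<in> carrier_mat n (c i)" and X: "X = block_row n k Xs"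
    using exists_block_row[OF Xc p] by metis
  let ?N = "stat_op A (X * mat_adjoint X)"
  have N: "?N \<in> carrier_mat n n" using A' Xc by simp
  have "\<forall>a<\<Sum>i<k. c i. ?N *\<^sub>v col (block_row n k Xs) a =
      of_real (vals ! fst (block_index k c ! a)) \<cdot>\<^sub>v col (block_row n k Xs) a"
    unfolding X[symmetric] XY p using colX f[OF \<pi>p] f\<pi> by simp
  then have "\<forall>i<k. \<forall>j<c i. ?N *\<^sub>v col (Xs i) j = of_real (vals ! fst (i, j)) \<cdot>\<^sub>v col (Xs i) j"
    by (rule all_col_block_row[where k = k and M = Xs and n = n and c = c
          and Q = "\<lambda>x v. ?N *\<^sub>v v = of_real (vals ! fst x) \<cdot>\<^sub>v v", OF Xs, THEN iffD1, rotated])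
  then have NX: "?N * Xs i = complex_of_real (vals ! i) \<cdot>\<^sub>m Xs i" if "i < k" for i
    using mult_eq_smult_iff[OF N Xs[OF that]] that by simp
  obtain rs Us \<sigma> Vs where "svd_block_structure n p k c rs Xs Us \<sigma> Vs X" "qomm_conditions n A k c rs Xs Us \<sigma> Vs"
    using stationary_blocks[of n A k Xs c X p vals, OF A Xs c X obX p vals NX] by blast
  \<comment> \<open>Column j of \<open>X\<close> is column \<open>\<pi> j\<close> of
    \<open>Y\<close>, so the way back from \<open>X\<close> to \<open>Y\<close> takes the inverse
    permutation.\<close>
  moreover define P where "P = mat p p (\<lambda>(i, j). if i = inv_into UNIV \<pi> j then 1 else (0 :: real))"
  have "permutation_matrix p P"
    unfolding permutation_matrix_def P_def using permutes_inv[OF \<pi>] by blast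
  moreover have "Y = X * map_mat complex_of_real P"
  proof (rule mat_col_eqI)
    fix j assume "j < dim_col (X * map_mat complex_of_real P)"
    then have j: "j < p" by (simp add: P_def)
    have "inv_into UNIV \<pi> j < p" using permutes_in_image[OF permutes_inv[OF \<pi>], of j] j by simp
    then show "col Y j = col (X * map_mat complex_of_real P) j"
      unfolding P_def col_mult_permutation[OF Xc permutes_inv[OF \<pi>] j]
      using colX permutes_inverses(1)[OF \<pi>] by simp
  qed (use Xc Yc in \<open>auto simp: P_def\<close>)
  ultimately show ?thesis by blast
qed

theorem theorem2p1:
  fixes n p :: nat and A :: "complex mat"
  assumes "1 \<le> p" and "p \<le> n"
    and "negative_definite_mat n A"
  shows
    "(\<forall>Y. qomm_stationary n p A Y \<longrightarrow>
        (\<exists>X P k ps rs Xs Us \<sigma> Vs.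
           permutation_matrix p P \<and> Y = X * map_mat complex_of_real P \<and>
           svd_block_structure n p k ps rs Xs Us \<sigma> Vs X \<and>
           qomm_conditions n A k ps rs Xs Us \<sigma> Vs)) \<and>
     (\<forall>q r U. 1 \<le> r \<and> r \<le> q \<and> q \<le> p \<and> U \<in> carrier_mat n r \<and>
        partial_unitary U \<and> diagonal_mat (mat_adjoint U * A * U) \<longrightarrow>
        (\<exists>V \<in> carrier_mat q r. partial_unitary V \<and>
           U * real_diag r (sigma_formula A q r U) * mat_adjoint V \<in> oblique_manifold n q)) \<and>
     (\<forall>X k ps rs Xs Us \<sigma> Vs.
        svd_block_structure n p k ps rs Xs Us \<sigma> Vs X \<and>
        qomm_conditions n A k ps rs Xs Us \<sigma> Vs \<longrightarrow>
        qomm_stationary n p A X \<and>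
        (\<forall>P. permutation_matrix p P \<longrightarrow>
           qomm_stationary n p A (X * map_mat complex_of_real P)))"
proof (intro conjI)
  note A = assms(3)
  have A': "A \<in> carrier_mat n n" using A by (simp add: negative_definite_mat_def)
  show "\<forall>Y. qomm_stationary n p A Y \<longrightarrow>
        (\<exists>X P k ps rs Xs Us \<sigma> Vs.
           permutation_matrix p P \<and> Y = X * map_mat complex_of_real P \<and>
           svd_block_structure n p k ps rs Xs Us \<sigma> Vs X \<and>
           qomm_conditions n A k ps rs Xs Us \<sigma> Vs)"
    using stationary_imp_conditions[OF A] by blast
  show "\<forall>q r U. 1 \<le> r \<and> r \<le> q \<and> q \<le> p \<and> U \<in> carrier_mat n r \<and>
        partial_unitary U \<and> diagonal_mat (mat_adjoint U * A * U) \<longrightarrow>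
        (\<exists>V \<in> carrier_mat q r. partial_unitary V \<and>
           U * real_diag r (sigma_formula A q r U) * mat_adjoint V \<in> oblique_manifold n q)"
    using right_singular_vectors_exist[OF A] by blast
  show "\<forall>X k ps rs Xs Us \<sigma> Vs.
        svd_block_structure n p k ps rs Xs Us \<sigma> Vs X \<and>
        qomm_conditions n A k ps rs Xs Us \<sigma> Vs \<longrightarrow>
        qomm_stationary n p A X \<and>
        (\<forall>P. permutation_matrix p P \<longrightarrow>
           qomm_stationary n p A (X * map_mat complex_of_real P))"
  proof (intro allI impI)
    fix X k ps rs Xs Us \<sigma> Vs
    assume "svd_block_structure n p k ps rs Xs Us \<sigma> Vs X \<and> qomm_conditions n A k ps rs Xs Us \<sigma> Vs"
    then have X: "qomm_stationary n p A X" using qomm_conditions_stationary[OF A] by blast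
    then have Xc: "X \<in> carrier_mat n p" by (simp add: qomm_stationary_def oblique_manifold_def)
    have "qomm_stationary n p A (X * map_mat complex_of_real P)" if perm: "permutation_matrix p P" for P
    proof -
      obtain \<pi> where \<pi>: "\<pi> permutes {..<p}" and P: "P = mat p p (\<lambda>(i, j). if i = \<pi> j then 1 else 0)"
        using perm by (auto simp: permutation_matrix_def)
      show ?thesis unfolding P
        by (rule qomm_stationary_permute_cols[OF A' X _ \<pi> col_mult_permutation[OF Xc \<pi>]]) (use Xc in auto)
    qed
    with X show "qomm_stationary n p A X \<and>
        (\<forall>P. permutation_matrix p P \<longrightarrow> qomm_stationary n p A (X * map_mat complex_of_real P))" by blast
  qed
qed

end
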